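(* Let $\alpha$ be a positive rational number and let $\mathcal T=(T,\nu)$ be a primitive factorization tree for $\alpha$. Let $r$ be a vertex of $T$ such that $\nu(r)$ is an optimal factorization (of the $\alpha_n$ of which it is a factorization). If $s$ is a separation vertex of $\mathcal T$ and $s$ is an ancestor of $r$, then $\nu(s)$ is also an optimal factorization.
   Context: Write $\alpha=a/b$ with $a,b$ coprime positive integers. Let $p_1\ge\cdots\ge p_N$ be the primes dividing $ab$, listed with multiplicity. Put $\gamma(i)=1$ if $p_i\mid a$, $\gamma(i)=-1$ if $p_i\mid b$, and $\alpha_n=\prod_{i=1}^n p_i^{\gamma(i)}$ for $0\le n\le N$. An integer $n$ with $0\le n\le N$ is a separation index for $\alpha$ if for every prime $p$, at least one of $|\alpha_n|_p$ and $|\alpha/\alpha_n|_p$ equals $1$ (where $|\cdot|_p$ is the $p$-adic absolute value). A factorization of a positive rational $\beta$ is a sequence $(a_1/b_1,a_2/b_2,\dots)$ with $a_i,b_i$ positive integers, $a_i=b_i=1$ for all but finitely many $i$, $\prod_i a_i/b_i=\beta$, $\max\{a_i,b_i\}\ge\max\{a_{i+1},b_{i+1}\}$ for all $i$, and $\gcd(a_i,b_j)=1$ for all $i,j$; it is primitive if each $\max\{a_i,b_i\}$ is prime or $1$. For nonzero algebraic $\beta$, $m(\beta)$ is its logarithmic Mahler measure ($m(x/y)=\log\max\{x,y\}$ for a positive rational $x/y$ in lowest terms) and $m_t(\beta)=\inf\{(\sum_{n=1}^M m(\beta_n)^t)^{1/t}: M\in\mathbb N,\ \beta_n\in\overline{\mathbb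 Q}^\times,\ \beta=\prod\beta_n\}$ for $t>0$. A factorization $(a_i/b_i)$ of $\beta$ is optimal if there is $T_0>0$ with $m_t(\beta)=(\sum_i m(a_i/b_i)^t)^{1/t}$ for all $t\ge T_0$. Let $\mathfrak F_\alpha$ ($\mathfrak P_\alpha$) be the set of all (primitive) factorizations of $\alpha_n$, $0\le n\le N$. For $0\le n<N$, a factorization $(a_i/b_i)$ of $\alpha_n$ is a direct subfactorization of a factorization $(c_i/d_i)$ of $\alpha_{n+1}$ if either $p_{n+1}\mid a$ and for some $k$: $d_i=b_i$ for all $i$, $c_i=a_i$ for $i\ne k$, $c_k=a_kp_{n+1}$; or $p_{n+1}\mid b$ and for some $k$: $c_i=a_i$ for all $i$, $d_i=b_i$ for $i\ne k$, $d_k=b_kp_{n+1}$. A factorization tree for $\alpha$ is a pair $(T,\nu)$ with $T$ a rooted tree and $\nu:V(T)\to\mathfrak F_\alpha$, with parenting map $\phi$, such that: (1) root $r_0$ has $\nu(r_0)=(1,1,\dots)$; (2) if $n<N$ and $\nu(r)$ is a factorization of $\alpha_n$ then $r$ has a child; (3) $\nu(r)=\nu(s)$ and $\phi(r)=\phi(s)$ imply $r=s$; (4) for non-root $r$, $\nu(\phi(r))$ is a direct subfactorization of $\nu(r)$. It is primitive if $\nu(V(T))\subseteq\mathfrak P_\alpha$. A vertex $s$ of a factorization tree is a separation vertex if $\nu(s)$ is a factorization of $\alpha_n$ for some separation index $n$ of $\alpha$. *)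

theory Defs
  imports "HOL-Analysis.Analysis" "Berlekamp_Zassenhaus.Mahler_Measure"
begin

section \<open>Mahler measure and the metric Mahler measures \<open>m\<^sub>t\<close>\<close>

text \<open>
  Irreducibility is over the integers: it forces the polynomial to be primitive, and, as
  \<open>p \<noteq> 0\<close> has a root, nonconstant. So \<open>p\<close> is unique for algebraic \<open>z\<close>.
\<close>
definition int_min_poly :: "complex \<Rightarrow> int poly" where
  "int_min_poly z =
     (THE p. irreducible p \<and> lead_coeff p > 0 \<and> poly (map_poly of_int p) z = 0)"

definition log_mahler :: "complex \<Rightarrow> real" where
  "log_mahler z = ln (mahler_measure (int_min_poly z))"

definition metric_mahler :: "real \<Rightarrow> complex \<Rightarrow> real" where
  "metric_mahler t z =
     Inf {(\<Sum>n=1..M. log_mahler (w n) powr t) powr (1 / t) | (M :: nat) w.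
            (\<forall>n\<in>{1..M}. algebraic (w n) \<and> w n \<noteq> 0) \<and> z = (\<Prod>n=1..M. w n)}"

section \<open>The rationals \<open>\<alpha>\<^sub>n\<close> and separation indices\<close>

definition numer :: "rat \<Rightarrow> nat" where
  "numer \<alpha> = nat (fst (quotient_of \<alpha>))"

definition denom :: "rat \<Rightarrow> nat" where
  "denom \<alpha> = nat (snd (quotient_of \<alpha>))"

definition prime_list :: "rat \<Rightarrow> nat list" where
  "prime_list \<alpha> = rev (sorted_list_of_multiset (prime_factorization (numer \<alpha> * denom \<alpha>)))"

definition nprimes :: "rat \<Rightarrow> nat" where
  "nprimes \<alpha> = length (prime_list \<alpha>)"

text \<open>The indices \<open>i\<close> of \<open>p\<^sub>i\<close> and \<open>\<gamma>(i)\<close> run from \<open>1\<close> to \<open>N = nprimes \<alpha>\<close>.\<close>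

definition nth_prime :: "rat \<Rightarrow> nat \<Rightarrow> nat" where
  "nth_prime \<alpha> i = prime_list \<alpha> ! (i - 1)"

definition gamma_sign :: "rat \<Rightarrow> nat \<Rightarrow> int" where
  "gamma_sign \<alpha> i = (if nth_prime \<alpha> i dvd numer \<alpha> then 1 else -1)"

definition partial_rat :: "rat \<Rightarrow> nat \<Rightarrow> rat" where
  "partial_rat \<alpha> n = (\<Prod>i=1..n. of_nat (nth_prime \<alpha> i) powi gamma_sign \<alpha> i)"

definition padic_valuation :: "nat \<Rightarrow> rat \<Rightarrow> int" where
  "padic_valuation p x =
     int (multiplicity (int p) (fst (quotient_of x)))
     - int (multiplicity (int p) (snd (quotient_of x)))"

definition padic_abs :: "nat \<Rightarrow> rat \<Rightarrow> real" where
  "padic_abs p x = (if x = 0 then 0 else real p powi (- padic_valuation p x))"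

definition separation_index :: "rat \<Rightarrow> nat \<Rightarrow> bool" where
  "separation_index \<alpha> n \<longleftrightarrow>
     n \<le> nprimes \<alpha> \<and>
     (\<forall>p. prime p \<longrightarrow>
        padic_abs p (partial_rat \<alpha> n) = 1 \<or> padic_abs p (\<alpha> / partial_rat \<alpha> n) = 1)"

section \<open>Factorizations\<close>

text \<open>
  The sequence \<open>(a\<^sub>1/b\<^sub>1, a\<^sub>2/b\<^sub>2, \<dots>)\<close> is a function on \<open>nat\<close>, with indices shifted to start at \<open>0\<close>;
  its values are the pairs \<open>(a\<^sub>i, b\<^sub>i)\<close>. As \<open>a\<^sub>i\<close> and \<open>b\<^sub>i\<close> are coprime, equality of such
  functions is equality of the sequences of fractions.
\<close>
type_synonym fact_seq = "nat \<Rightarrow> nat \<times> nat"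

abbreviation top_of :: "fact_seq \<Rightarrow> nat \<Rightarrow> nat" where
  "top_of f i \<equiv> fst (f i)"

abbreviation bot_of :: "fact_seq \<Rightarrow> nat \<Rightarrow> nat" where
  "bot_of f i \<equiv> snd (f i)"

definition factorization :: "rat \<Rightarrow> fact_seq \<Rightarrow> bool" where
  "factorization \<beta> f \<longleftrightarrow>
     (\<forall>i. top_of f i > 0 \<and> bot_of f i > 0) \<and>
     finite {i. f i \<noteq> (1, 1)} \<and>
     (\<Prod>i\<in>{i. f i \<noteq> (1, 1)}. of_nat (top_of f i) / of_nat (bot_of f i)) = \<beta> \<and>
     (\<forall>i. max (top_of f i) (bot_of f i) \<ge> max (top_of f (Suc i)) (bot_of f (Suc i))) \<and>
     (\<forall>i j. gcd (top_of f i) (bot_of f j) = 1)"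

definition primitive_factorization :: "rat \<Rightarrow> fact_seq \<Rightarrow> bool" where
  "primitive_factorization \<beta> f \<longleftrightarrow>
     factorization \<beta> f \<and>
     (\<forall>i. prime (max (top_of f i) (bot_of f i)) \<or> max (top_of f i) (bot_of f i) = 1)"

definition optimal_factorization :: "rat \<Rightarrow> fact_seq \<Rightarrow> bool" where
  "optimal_factorization \<beta> f \<longleftrightarrow>
     factorization \<beta> f \<and>
     (\<exists>T0>0. \<forall>t\<ge>T0.
        metric_mahler t (of_rat \<beta>) =
        (\<Sum>i. log_mahler (of_nat (top_of f i) / of_nat (bot_of f i)) powr t) powr (1 / t))"

definition factorizations_of :: "rat \<Rightarrow> fact_seq set" where
  "factorizations_of \<alpha> = {f. \<exists>n\<le>nprimes \<alpha>. factorization (partial_rat \<alpha> n) f}"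

definition primitive_factorizations_of :: "rat \<Rightarrow> fact_seq set" where
  "primitive_factorizations_of \<alpha> =
     {f. \<exists>n\<le>nprimes \<alpha>. primitive_factorization (partial_rat \<alpha> n) f}"

definition direct_subfactorization :: "rat \<Rightarrow> nat \<Rightarrow> fact_seq \<Rightarrow> fact_seq \<Rightarrow> bool" where
  "direct_subfactorization \<alpha> n f g \<longleftrightarrow>
     n < nprimes \<alpha> \<and>
     factorization (partial_rat \<alpha> n) f \<and>
     factorization (partial_rat \<alpha> (n + 1)) g \<and>
     (nth_prime \<alpha> (n + 1) dvd numer \<alpha> \<and>
        (\<exists>k. (\<forall>i. bot_of g i = bot_of f i) \<and>
             (\<forall>i. i \<noteq> k \<longrightarrow> top_of g i = top_of f i) \<and>
             top_of g k = top_of f k * nth_prime \<alpha> (n + 1))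
      \<or>
      nth_prime \<alpha> (n + 1) dvd denom \<alpha> \<and>
        (\<exists>k. (\<forall>i. top_of g i = top_of f i) \<and>
             (\<forall>i. i \<noteq> k \<longrightarrow> bot_of g i = bot_of f i) \<and>
             bot_of g k = bot_of f k * nth_prime \<alpha> (n + 1)))"

section \<open>Factorization trees\<close>

text \<open>
  A rooted tree is presented by its vertices, its root and its parenting map; the value of the
  parenting map at the root, or outside the vertex set, has no meaning.
\<close>
record 'v rooted_tree =
  vertices :: "'v set"
  root_vertex :: 'v
  parent :: "'v \<Rightarrow> 'v"

definition parent_rel :: "'v rooted_tree \<Rightarrow> ('v \<times> 'v) set" where
  "parent_rel T = {(v, parent T v) | v. v \<in> vertices T \<and> v \<noteq> root_vertex T}"

text \<open>
  Acyclicity needs no separate clause: from every vertex the parenting map leads to the root,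
  which has no parent.
\<close>
definition is_rooted_tree :: "'v rooted_tree \<Rightarrow> bool" where
  "is_rooted_tree T \<longleftrightarrow>
     root_vertex T \<in> vertices T \<and>
     (\<forall>v\<in>vertices T - {root_vertex T}. parent T v \<in> vertices T) \<and>
     (\<forall>v\<in>vertices T. (v, root_vertex T) \<in> (parent_rel T)\<^sup>*)"

text \<open>A vertex counts as an ancestor of itself.\<close>
definition is_ancestor :: "'v rooted_tree \<Rightarrow> 'v \<Rightarrow> 'v \<Rightarrow> bool" where
  "is_ancestor T s r \<longleftrightarrow> s \<in> vertices T \<and> r \<in> vertices T \<and> (r, s) \<in> (parent_rel T)\<^sup>*"

definition factorization_tree :: "rat \<Rightarrow> 'v rooted_tree \<Rightarrow> ('v \<Rightarrow> fact_seq) \<Rightarrow> bool" where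
  "factorization_tree \<alpha> T \<nu> \<longleftrightarrow>
     is_rooted_tree T \<and>
     \<nu> ` vertices T \<subseteq> factorizations_of \<alpha> \<and>
     \<nu> (root_vertex T) = (\<lambda>i. (1, 1)) \<and>
     (\<forall>r\<in>vertices T. \<forall>n<nprimes \<alpha>. factorization (partial_rat \<alpha> n) (\<nu> r) \<longrightarrow>
        (\<exists>s\<in>vertices T - {root_vertex T}. parent T s = r)) \<and>
     (\<forall>r\<in>vertices T - {root_vertex T}. \<forall>s\<in>vertices T - {root_vertex T}.
        \<nu> r = \<nu> s \<and> parent T r = parent T s \<longrightarrow> r = s) \<and>
     (\<forall>r\<in>vertices T - {root_vertex T}.
        \<exists>n. direct_subfactorization \<alpha> n (\<nu> (parent T r)) (\<nu> r))"

definition primitive_factorization_tree ::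
    "rat \<Rightarrow> 'v rooted_tree \<Rightarrow> ('v \<Rightarrow> fact_seq) \<Rightarrow> bool" where
  "primitive_factorization_tree \<alpha> T \<nu> \<longleftrightarrow>
     factorization_tree \<alpha> T \<nu> \<and> \<nu> ` vertices T \<subseteq> primitive_factorizations_of \<alpha>"

definition separation_vertex ::
    "rat \<Rightarrow> 'v rooted_tree \<Rightarrow> ('v \<Rightarrow> fact_seq) \<Rightarrow> 'v \<Rightarrow> bool" where
  "separation_vertex \<alpha> T \<nu> s \<longleftrightarrow>
     s \<in> vertices T \<and>
     (\<exists>n. separation_index \<alpha> n \<and> factorization (partial_rat \<alpha> n) (\<nu> s))"

end

theory Submission
  imports Defs "Berlekamp_Zassenhaus.Factor_Bound"
begin

hide_const (open) Module.smult UnivPoly.coeff UnivPoly.monom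

text \<open>
  Let the vertex \<open>s\<close> carry a factorization of \<open>\<alpha>\<^sub>n\<close> and its descendant \<open>r\<close> an optimal one of
  \<open>\<alpha>\<^sub>m\<close>, \<open>n \<le> m\<close>. Going down the tree only multiplies numerators and denominators, so at each
  \<open>t\<close> the cost of \<open>\<nu>(s)\<close> is at most the cost of \<open>\<nu>(r)\<close>. Since \<open>n\<close> is a separation index, every
  nontrivial entry of \<open>\<nu>(s)\<close> has size greater than each of \<open>p\<^sub>n\<^sub>+\<^sub>1, \<dots>, p\<^sub>m\<close>. For large \<open>t\<close>
  the costs \<open>\<Sum> (log k)\<^sup>t\<close> compare multisets of integers lexicographically; hence a rational
  factorization of \<open>\<alpha>\<^sub>n\<close> cheaper than \<open>\<nu>(s)\<close> stays cheaper than \<open>\<nu>(s)\<close> after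
  appending \<open>p\<^sub>n\<^sub>+\<^sub>1, \<dots>, p\<^sub>m\<close> one by one, and so would beat the optimal factorization
  \<open>\<nu>(r)\<close>. Arbitrary algebraic factorizations reduce to rational ones: if \<open>y\<close> and \<open>x\<close> are the
  absolute values of the leading and constant coefficients of the minimal polynomial of \<open>\<beta>\<close>, then
  \<open>y\<beta>\<close> and \<open>x/\<beta>\<close> are algebraic integers and \<open>max x y\<close> is at most the Mahler measure of \<open>\<beta>\<close>.
\<close>

section \<open>Mahler measure and integer minimal polynomials\<close>

text \<open>Among the nonzero integer polynomials vanishing at \<open>z\<close>, one of least degree
  has a primitive part that divides all the others. Each irreducible one is therefore associated to
  that primitive part.\<close>

lemma irreducible_common_root_dvd:
  fixes p q :: "int poly" and z :: complex
  assumes p: "irreducible p" "poly (map_poly of_int p) z = 0"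
    and q: "irreducible q" "poly (map_poly of_int q) z = 0"
  shows "p dvd q"
proof -
  let ?S = "\<lambda>f. f \<noteq> (0::int poly) \<and> poly (map_poly of_int f) z = 0"
  have "?S p" using p by auto
  then obtain m where m: "?S m" and min: "\<And>f. ?S f \<Longrightarrow> degree m \<le> degree f"
    using ex_has_least_nat[of ?S p degree] by blast
  define m' where "m' = primitive_part m"
  have m'dvd: "m' dvd f" if f: "poly (map_poly of_int f) z = 0" for f
  proof -
    \<comment> \<open>Pseudo-division stays inside the integer polynomials at the price of scaling
      \<open>f\<close>; minimality kills the remainder, and Gauss's lemma removes the factor
      \<open>a\<close> once \<open>m\<close> is made primitive.\<close>
    obtain a s where a: "a \<noteq> 0" "smult a f = m * s + pseudo_mod f m"
      using pseudo_mod(1)[of m f] m by blast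
    have r: "pseudo_mod f m = 0 \<or> degree (pseudo_mod f m) < degree m"
      using pseudo_mod(2)[of m f] m by blast
    have "pseudo_mod f m = smult a f - m * s" using a by simp
    hence "poly (map_poly of_int (pseudo_mod f m)) z = 0"
      using m f by (simp add: hom_distribs)
    hence "pseudo_mod f m = 0" using r min[of "pseudo_mod f m"] by force
    hence "m dvd smult a f" using a by simp
    thus ?thesis unfolding m'_def using a(1) by (rule dvd_smult_int[rotated])
  qed
  have "poly (map_poly of_int (smult (content m) m')) z = 0"
    using m unfolding m'_def content_times_primitive_part by blast
  hence "poly (map_poly of_int m') z = 0"
    using m by (simp add: hom_distribs)
  hence nu: "\<not> is_unit m'"
    using m by (auto simp: is_unit_poly_iff)
  have "f dvd m'" if "irreducible f" "poly (map_poly of_int f) z = 0" for f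
    using irreducibleD'[OF that(1) m'dvd[OF that(2)]] nu by blast
  thus ?thesis using p m'dvd[OF q(2)] by (meson dvd_trans)
qed

text \<open>Two candidates divide each other, so they differ by a constant unit 1 or -1, and the
  sign of the leading coefficients excludes -1.\<close>

lemma int_min_poly_eqI:
  assumes "irreducible p" "lead_coeff p > 0" "poly (map_poly of_int p) z = 0"
  shows "int_min_poly z = p"
  unfolding int_min_poly_def
proof (rule the_equality)
  fix q assume q: "irreducible q \<and> lead_coeff q > 0 \<and> poly (map_poly of_int q) z = 0"
  have "p dvd q" "q dvd p"
    using irreducible_common_root_dvd assms q by blast+
  moreover have "p \<noteq> 0" using assms(1) by auto
  ultimately obtain a where a: "is_unit a" "q = a * p"
    by (metis dvdE dvd_mult_cancel_left mult.commute mult.right_neutral)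
  then obtain c where c: "a = [:c:]" "c dvd 1" by (auto simp: is_unit_poly_iff)
  hence "lead_coeff q = c * lead_coeff p" using a by simp
  hence "c > 0" using q assms(2) by (simp add: zero_less_mult_iff)
  hence "c = 1" using c by simp
  thus "q = p" using a c by simp
qed (use assms in auto)

text \<open>Some prime factor of an integer polynomial vanishing at \<open>z\<close> must itself
  vanish there; a change of sign then makes the leading coefficient positive.\<close>

lemma ex_irreducible_root:
  assumes "algebraic (z :: complex)"
  shows "\<exists>p. irreducible p \<and> lead_coeff p > 0 \<and> poly (map_poly of_int p) z = 0"
proof -
  obtain P where P: "poly (map_poly of_int P) z = 0" "P \<noteq> 0"
    using assms by (elim algebraicE') auto
  have "\<exists>p. irreducible p \<and> p dvd P \<and> poly (map_poly of_int p) z = 0"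
    using P(2,1)
  proof (induction P rule: prime_divisors_induct)
    case zero thus ?case by simp
  next
    case (unit x) thus ?case by (auto simp: is_unit_poly_iff)
  next
    case (factor p x)
    show ?case
    proof (cases "poly (map_poly of_int p) z = 0")
      case True
      thus ?thesis using factor by (intro exI[of _ p]) (auto intro: prime_elem_imp_irreducible)
    next
      case False
      hence "poly (map_poly of_int x) z = 0" "x \<noteq> 0" using factor by (auto simp: hom_distribs)
      thus ?thesis using factor.IH by auto
    qed
  qed
  then obtain p where p: "irreducible p" "poly (map_poly of_int p) z = 0" by blast
  show ?thesis
  proof (cases "lead_coeff p > 0")
    case False
    hence "lead_coeff (-p) > 0" using p by (auto simp: not_less le_less)
    thus ?thesis using p by (intro exI[of _ "-p"]) (auto simp: hom_distribs)
  qed (use p in auto)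
qed

text \<open>The minimal polynomial is bX - a, primitive by coprimality, and its Mahler measure is b
  max(1, a/b).\<close>

lemma log_mahler_of_rat:
  assumes "Rings.coprime a b" "a > 0" "b > 0"
  shows "log_mahler (of_nat a / of_nat b) = ln (real (max a b))"
proof -
  let ?p = "[:- int a, int b:]"
  have "content ?p = 1"
    using assms by (simp add: content_def)
  moreover have "degree ?p = 1" using assms by simp
  ultimately have "irreducible ?p"
    using irreducible_primitive_connect[of ?p] linear_irreducible\<^sub>d[of ?p] by (auto simp: primitive_iff_content_eq_1)
  hence "int_min_poly (of_nat a / of_nat b) = ?p"
    using assms by (intro int_min_poly_eqI) (auto simp: field_simps)
  moreover have "mahler_measure ?p = max a b"
  proof -
    have "map_poly of_int ?p = smult (of_nat b) (\<Prod>x\<leftarrow>[of_nat a / of_nat b]. [:- x, 1:] :: complex poly)"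
      using assms by simp
    hence "mahler_measure ?p = real b * max 1 (real a / real b)"
      unfolding mahler_measure_def
      by (simp only: mahler_measure_poly_explicit) (simp add: norm_divide)
    also have "\<dots> = max a b"
      using assms by (auto simp: max_def field_simps)
    finally show ?thesis .
  qed
  ultimately show ?thesis by (simp add: log_mahler_def)
qed

text \<open>With leading coefficient l and degree d, multiplying p(X) by l^(d-1) gives a monic
  integer polynomial in lX; this is \<open>q\<close>.\<close>

lemma algebraic_int_lead_coeff_mult:
  fixes p :: "int poly" and z :: complex
  assumes "poly (map_poly of_int p) z = 0" "p \<noteq> 0"
  shows "algebraic_int (of_int (lead_coeff p) * z)"
proof -
  define d where "d = degree p"
  define l where "l = lead_coeff p"
  define q where "q = monom 1 d + (\<Sum>i<d. monom (coeff p i * l ^ (d - 1 - i)) i)"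
  have l0: "l \<noteq> 0" using assms by (simp add: l_def)
  \<comment> \<open>A nonzero polynomial with a root is not constant; this keeps the truncated
    exponent \<open>d - 1\<close> meaningful.\<close>
  have d0: "d > 0"
    using assms by (intro Nat.gr0I) (auto simp: d_def hom_distribs elim!: degree_eq_zeroE)
  have cq: "coeff q d = 1" "\<And>i. i > d \<Longrightarrow> coeff q i = 0"
    by (auto simp: q_def coeff_sum)
  hence "degree q = d"
    by (metis degree_le le_antisym le_degree one_neq_zero)
  hence "lead_coeff q = 1" using cq by simp
  moreover have "poly (map_poly of_int q) (of_int l * z) = 0"
  proof -
    have "poly (map_poly of_int q) (of_int l * z) =
       (of_int l * z) ^ d + (\<Sum>i<d. of_int (coeff p i * l ^ (d - 1 - i)) * (of_int l * z) ^ i)"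
      by (simp add: q_def hom_distribs poly_monom poly_sum)
    also have "(\<Sum>i<d. of_int (coeff p i * l ^ (d - 1 - i)) * (of_int l * z) ^ i)
       = (\<Sum>i<d. of_int l ^ (d - 1) * (of_int (coeff p i) * z ^ i))"
    proof (rule sum.cong[OF refl])
      fix i assume "i \<in> {..<d}"
      hence "of_int l ^ (d - 1) = (of_int l ^ (d - 1 - i) * of_int l ^ i :: complex)"
        by (simp flip: power_add)
      thus "of_int (coeff p i * l ^ (d - 1 - i)) * (of_int l * z) ^ i = of_int l ^ (d - 1) * (of_int (coeff p i) * z ^ i)"
        by (simp add: power_mult_distrib)
    qed
    also have "(of_int l * z) ^ d = of_int l ^ (d - 1) * (of_int (coeff p d) * z ^ d)"
      using d0 by (cases d) (auto simp: power_mult_distrib l_def d_def)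
    also have "of_int l ^ (d - 1) * (of_int (coeff p d) * z ^ d) + (\<Sum>i<d. of_int l ^ (d - 1) * (of_int (coeff p i) * z ^ i))
       = of_int l ^ (d - 1) * (\<Sum>i\<le>d. of_int (coeff p i) * z ^ i)"
      by (simp add: sum_distrib_left distrib_left lessThan_Suc_atMost[symmetric])
    also have "(\<Sum>i\<le>d. of_int (coeff p i) * z ^ i) = poly (map_poly of_int p) z"
      by (simp add: poly_altdef d_def)
    finally show ?thesis using assms by simp
  qed
  ultimately show ?thesis
    unfolding algebraic_int_altdef_ipoly l_def by blast
qed

text \<open>The witnesses are the absolute values of the constant and leading coefficients of the
  minimal polynomial. The claim about 1/z is the claim about z for the reflected polynomial.\<close>

lemma ex_nat_bounds_log_mahler:
  assumes "algebraic z" "z \<noteq> 0"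
  shows "\<exists>x y. x > 0 \<and> y > 0 \<and> algebraic_int (of_nat x / z) \<and> algebraic_int (of_nat y * z)
     \<and> ln (real (max x y)) \<le> log_mahler z"
proof -
  obtain p where p: "irreducible p" "lead_coeff p > 0" "poly (map_poly of_int p) z = 0"
    using ex_irreducible_root[OF assms(1)] by blast
  have imp: "int_min_poly z = p" using int_min_poly_eqI p by blast
  \<comment> \<open>Otherwise X divides the irreducible \<open>p\<close>, so \<open>p\<close> is a
    unit times X and its only root is 0.\<close>
  have c0: "coeff p 0 \<noteq> 0"
  proof
    assume "coeff p 0 = 0"
    then obtain s where s: "p = [:0, 1:] * s" by (cases p) auto
    hence "is_unit s"
      using irreducibleD[OF p(1) s] by (auto simp: is_unit_poly_iff)
    thus False using p s assms by (auto simp: is_unit_poly_iff hom_distribs)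
  qed
  define x y where "x = nat \<bar>coeff p 0\<bar>" and "y = nat (lead_coeff p)"
  have "algebraic_int (of_nat y * z)"
    using algebraic_int_lead_coeff_mult[OF p(3)] p by (auto simp: y_def)
  moreover have "algebraic_int (of_nat x / z)"
  proof -
    have "poly (map_poly of_int (reflect_poly p)) (inverse z) = 0"
    proof -
      have "map_poly of_int (reflect_poly p) = (reflect_poly (map_poly of_int p) :: complex poly)"
        by (intro poly_eqI) (simp add: coeff_reflect_poly)
      thus ?thesis
        using poly_reflect_poly_nz[of "inverse z" "map_poly of_int p"] assms p by simp
    qed
    hence "algebraic_int (of_int (lead_coeff (reflect_poly p)) * inverse z)"
      using c0 by (intro algebraic_int_lead_coeff_mult) auto
    hence "algebraic_int (of_int (coeff p 0) / z)"
      using c0 by (simp add: divide_inverse coeff_reflect_poly)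
    thus ?thesis unfolding x_def
      by (cases "coeff p 0 \<ge> 0") (auto simp: abs_if algebraic_int_minus_iff)
  qed
  \<comment> \<open>In Mignotte's bound the binomial factor of the two extreme coefficients is
    1.\<close>
  moreover have "real x \<le> mahler_measure p"
    using Mignotte_bound[of p 0] by (simp add: x_def)
  moreover have "real y \<le> mahler_measure p"
    using Mignotte_bound[of p "degree p"] p by (simp add: y_def)
  ultimately show ?thesis using c0 p
    unfolding log_mahler_def imp
    by (intro exI[of _ x] exI[of _ y]) (auto simp: x_def y_def ln_le_cancel_iff)
qed

section \<open>Rational products of algebraic integers\<close>

interpretation zmod: Modules.module "\<lambda>(c::int) (x::complex). of_int c * x"
  by unfold_locales (auto simp: algebra_simps)

text \<open>Integrality over the integers, expressed as containment of Z[x] in a finitely generated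
  additive group. In this form it passes to products without exhibiting a polynomial for the
  product.\<close>

definition powers_fg :: "complex \<Rightarrow> bool" where
  "powers_fg x \<longleftrightarrow> (\<exists>S. finite S \<and> (\<forall>k. x ^ k \<in> zmod.span S))"

text \<open>The monic relation rewrites x^d through lower powers, so strong induction reduces every
  power to the first d ones.\<close>

lemma algebraic_int_imp_powers_fg:
  assumes "algebraic_int x" shows "powers_fg x"
proof -
  obtain p where p: "poly (map_poly of_int p) x = 0" "lead_coeff p = (1 :: int)"
    using assms unfolding algebraic_int_altdef_ipoly by blast
  define d where "d = degree p"
  let ?V = "zmod.span ((\<lambda>i. x ^ i) ` {..<d})"
  have "0 = (\<Sum>i\<le>d. of_int (coeff p i) * x ^ i)"
    using p by (simp add: poly_altdef d_def)
  also have "\<dots> = (\<Sum>i<d. of_int (coeff p i) * x ^ i) + x ^ d"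
    using p by (simp add: d_def lessThan_Suc_atMost[symmetric])
  finally have xd: "x ^ d = (\<Sum>i<d. of_int (- coeff p i) * x ^ i)"
    by (simp add: sum_negf eq_neg_iff_add_eq_0 add.commute)
  have "x ^ k \<in> ?V" for k
  proof (induction k rule: less_induct)
    case (less k)
    show ?case
    proof (cases "k < d")
      case True thus ?thesis by (intro zmod.span_base) auto
    next
      case False
      hence "x ^ k = x ^ (k - d) * x ^ d" by (simp flip: power_add)
      also have "\<dots> = (\<Sum>i<d. of_int (- coeff p i) * x ^ (k - d + i))"
        unfolding xd by (simp add: sum_distrib_left power_add mult_ac)
      also have "\<dots> \<in> ?V"
        using False by (intro zmod.span_sum zmod.span_scale less) auto
      finally show ?thesis .
    qed
  qed
  thus ?thesis unfolding powers_fg_def by blast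
qed

text \<open>By bilinearity: the outer induction expands \<open>x\<close> into generators, the inner
  one expands \<open>y\<close>.\<close>

lemma zspan_mult:
  assumes "x \<in> zmod.span S" "y \<in> zmod.span T"
  shows "x * y \<in> zmod.span ((\<lambda>(a, b). a * b) ` (S \<times> T))"
  using assms(1)
proof (induction rule: zmod.span_induct_alt)
  case base thus ?case by (simp add: zmod.span_zero)
next
  case (step c a u)
  have "a * y \<in> zmod.span ((\<lambda>(a, b). a * b) ` (S \<times> T))"
    using assms(2)
  proof (induction rule: zmod.span_induct_alt)
    case base thus ?case by (simp add: zmod.span_zero)
  next
    case (step c b v)
    have "a * b \<in> (\<lambda>(a, b). a * b) ` (S \<times> T)" using step \<open>a \<in> S\<close> by auto
    from zmod.span_add[OF zmod.span_scale[OF zmod.span_base[OF this], of c] step(2)]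
    show ?case by (simp add: algebra_simps)
  qed
  from zmod.span_add[OF zmod.span_scale[OF this, of c] step(2)]
  show ?case by (simp add: algebra_simps)
qed

lemma powers_fg_mult:
  assumes "powers_fg x" "powers_fg y" shows "powers_fg (x * y)"
proof -
  obtain S T where "finite S" "finite T" "\<And>k. x ^ k \<in> zmod.span S" "\<And>k. y ^ k \<in> zmod.span T"
    using assms unfolding powers_fg_def by metis
  thus ?thesis unfolding powers_fg_def power_mult_distrib
    by (intro exI[of _ "(\<lambda>(a, b). a * b) ` (S \<times> T)"]) (auto intro: zspan_mult)
qed

lemma powers_fg_prod:
  assumes "\<And>i. i \<in> I \<Longrightarrow> powers_fg (f i)"
  shows "powers_fg (prod f I)"
proof -
  have 1: "powers_fg 1" by (rule algebraic_int_imp_powers_fg) simp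
  show ?thesis using assms
  proof (induction I rule: infinite_finite_induct)
    case (insert i I)
    hence "powers_fg (f i * prod f I)" by (intro powers_fg_mult) simp_all
    thus ?case using insert.hyps by simp
  qed (simp_all add: 1)
qed

text \<open>
  A rational number all of whose powers lie in a finitely generated additive subgroup of
  \<open>\<complex>\<close> is an integer: a \<open>\<rat>\<close>-linear functional fixing \<open>1\<close> bounds the denominators of its powers.
\<close>
lemma ex_rat_linear_functional:
  "\<exists>L :: complex \<Rightarrow> rat. (\<forall>x y. L (x + y) = L x + L y) \<and> (\<forall>c x. L (of_rat c * x) = c * L x) \<and> L 1 = 1"
proof -
  interpret vp: vector_space_pair "\<lambda>(c::rat) (x::complex). of_rat c * x" "(*) :: rat \<Rightarrow> rat \<Rightarrow> rat"
    by unfold_locales (auto simp: algebra_simps of_rat_add of_rat_mult)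
  have ind: "vp.vs1.independent {1 :: complex}" by simp
  \<comment> \<open>\<open>construct\<close> extends the value prescribed on the independent set
    \<open>{1}\<close> linearly to all complex numbers.\<close>
  define L where "L = vp.construct {1} (\<lambda>_. 1)"
  have "L 1 = 1" unfolding L_def using vp.construct_basis[OF ind] by simp
  moreover have "Vector_Spaces.linear (\<lambda>(c::rat) (x::complex). of_rat c * x) (*) L"
    unfolding L_def by (rule vp.linear_construct[OF ind])
  note lin = this[unfolded Vector_Spaces.linear_iff, THEN conjunct2, THEN conjunct2]
  ultimately show ?thesis using lin by (intro exI[of _ L] conjI) simp_all
qed

lemma powers_fg_rat_imp_int:
  assumes "powers_fg (of_rat u)" shows "u \<in> \<int>"
proof -
  obtain S where S: "finite S" "\<And>k. of_rat u ^ k \<in> zmod.span S"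
    using assms unfolding powers_fg_def by blast
  obtain L :: "complex \<Rightarrow> rat" where L: "\<And>x y. L (x + y) = L x + L y"
      "\<And>c x. L (of_rat c * x) = c * L x" "L 1 = 1"
    using ex_rat_linear_functional by blast
  \<comment> \<open>A common denominator for the values of \<open>L\<close> on the generators, hence
    on their whole integral span.\<close>
  define D where "D = (\<Prod>s\<in>S. snd (quotient_of (L s)))"
  have D0: "D > 0" unfolding D_def by (intro prod_pos) (simp add: quotient_of_denom_pos')
  have DL: "of_int D * L x \<in> \<int>" if "x \<in> zmod.span S" for x
    using that
  proof (induction rule: zmod.span_induct_alt)
    case base
    have "L 0 = 0" using L(2)[of 0 0] by simp
    thus ?case by simp
  next
    case (step c s y)
    have "D = snd (quotient_of (L s)) * (\<Prod>s\<in>S - {s}. snd (quotient_of (L s)))"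
      unfolding D_def using S(1) step(1) by (simp add: prod.remove)
    moreover have "of_int (snd (quotient_of (L s))) * L s = of_int (fst (quotient_of (L s)))"
      using quotient_of_div[of "L s" "fst (quotient_of (L s))" "snd (quotient_of (L s))"]
        quotient_of_denom_pos'[of "L s"] by (simp add: field_simps)
    ultimately have "of_int D * L s = of_int (fst (quotient_of (L s)) * (\<Prod>s\<in>S - {s}. snd (quotient_of (L s))))"
      by (simp add: mult_ac del: of_int_prod)
    hence "of_int D * L s \<in> \<int>" by (metis Ints_of_int)
    moreover have "L (of_int c * s + y) = of_int c * L s + L y"
      using L(1) L(2)[of "of_int c" s] by simp
    hence "of_int D * L (of_int c * s + y) = of_int c * (of_int D * L s) + of_int D * L y"
      by (simp add: algebra_simps)
    ultimately show ?case using step(2) by (metis Ints_add Ints_mult Ints_of_int)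
  qed
  obtain a b where ab: "quotient_of u = (a, b)" by force
  note b = quotient_of_denom_pos[OF ab] quotient_of_coprime[OF ab]
  note u = quotient_of_div[OF ab]
  \<comment> \<open>\<open>L\<close> fixes rationals, so D u^k is an integer; as a and b are
    coprime, D must absorb all of b^k.\<close>
  have "b ^ k dvd D" for k
  proof -
    have "L (of_rat u ^ k) = u ^ k"
      using L(2)[of "u ^ k" 1] L(3) by (simp add: of_rat_power)
    then obtain c where "of_int D * u ^ k = of_int c"
      using DL[OF S(2)[of k]] by (auto elim!: Ints_cases)
    hence "(of_int (D * a ^ k) :: rat) = of_int (c * b ^ k)"
      using b by (simp add: u field_simps power_divide)
    hence "b ^ k dvd D * a ^ k" by (simp only: of_int_eq_iff) simp
    moreover have "Rings.coprime (b ^ k) (a ^ k)" using b(2) by (simp add: ac_simps)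
    ultimately show ?thesis using coprime_dvd_mult_left_iff by blast
  qed
  \<comment> \<open>The exponent D suffices: for b at least 2 the power is at least 2^D, which
    exceeds D.\<close>
  hence "b ^ nat D \<le> D" by (intro zdvd_imp_le D0)
  have "b = 1"
  proof (rule ccontr)
    assume "b \<noteq> 1"
    hence "(2::int) ^ nat D \<le> b ^ nat D" using b by (intro power_mono) auto
    moreover have "int (nat D) < 2 ^ nat D" by (rule of_nat_less_two_power)
    ultimately show False using \<open>b ^ nat D \<le> D\<close> D0 by linarith
  qed
  thus ?thesis using u by simp
qed

lemma prod_algebraic_int_rat:
  fixes f :: "'a \<Rightarrow> complex"
  assumes "\<And>i. i \<in> I \<Longrightarrow> algebraic_int (f i)" "prod f I = of_rat u"
  shows "u \<in> \<int>"
proof (rule powers_fg_rat_imp_int)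
  show "powers_fg (of_rat u)"
    unfolding assms(2)[symmetric] by (intro powers_fg_prod algebraic_int_imp_powers_fg assms(1))
qed

section \<open>Reduction to rational factorizations\<close>

text \<open>One factor at a time is split off the divisor. This later shrinks the integers coming
  from minimal polynomials until their products are exactly the required numerator and
  denominator.\<close>

lemma dvd_prod_decomp:
  fixes A :: nat
  assumes "finite I" "A dvd prod x I"
  shows "\<exists>x'. (\<forall>i\<in>I. x' i dvd x i) \<and> prod x' I = A"
  using assms
proof (induction I arbitrary: A rule: finite_induct)
  case (insert i I)
  then obtain b c where bc: "A = b * c" "b dvd x i" "c dvd prod x I"
    using division_decomp[of A "x i" "prod x I"] by auto
  then obtain x' where "\<forall>i\<in>I. x' i dvd x i" "prod x' I = c" using insert.IH by blast
  moreover have "prod (x'(i := b)) I = prod x' I"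
    using insert.hyps by (intro prod.cong) auto
  ultimately show ?case using insert.hyps bc by (intro exI[of _ "x'(i := b)"]) auto
qed simp

lemma of_nat_div_in_Ints_imp_dvd:
  assumes "(of_nat m / of_nat n :: rat) \<in> \<int>" "n > 0"
  shows "n dvd m"
proof -
  obtain k where "(of_nat m / of_nat n :: rat) = of_int k" using assms(1) by (auto elim: Ints_cases)
  hence "(of_int (int m) :: rat) = of_int (k * int n)" using assms(2) by (simp add: field_simps)
  hence "int m = k * int n" by (simp only: of_int_eq_iff)
  thus ?thesis by (metis dvd_triv_right int_dvd_int_iff)
qed

text \<open>The product of the scaled factors is rational and a product of algebraic integers, so it
  is an integer; coprimality then puts the denominator into the scaling factors.\<close>

lemma prod_scaled_algebraic_int_dvd:
  fixes w :: "'a \<Rightarrow> complex"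
  assumes "finite I" "\<And>i. i \<in> I \<Longrightarrow> algebraic_int (of_nat (y i) * w i)"
    and "prod w I = of_nat A / of_nat B" "Rings.coprime A B" "B > 0"
  shows "B dvd prod y I"
proof -
  have "(\<Prod>i\<in>I. of_nat (y i) * w i) = of_rat (of_nat (prod y I * A) / of_nat B)"
    using assms(3) by (simp add: prod.distrib of_rat_divide of_rat_mult del: of_nat_prod flip: of_nat_prod)
  hence "(of_nat (prod y I * A) / of_nat B :: rat) \<in> \<int>"
    using assms(2) by (rule prod_algebraic_int_rat[rotated])
  hence "B dvd prod y I * A" using assms(5) by (rule of_nat_div_in_Ints_imp_dvd)
  thus ?thesis using assms(4) by (metis Rings.coprime_commute coprime_dvd_mult_left_iff)
qed

text \<open>Every algebraic factorization is bounded below, factor by factor, by a rational one.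
  Passing to divisors of the integers attached to each factor only decreases the maxima.\<close>

lemma rational_factorization_below:
  fixes w :: "'a \<Rightarrow> complex"
  assumes "finite I" "\<And>i. i \<in> I \<Longrightarrow> algebraic (w i) \<and> w i \<noteq> 0"
    and "prod w I = of_nat A / of_nat B" "Rings.coprime A B" "A > 0" "B > 0"
  shows "\<exists>x y. prod x I = A \<and> prod y I = B \<and>
           (\<forall>i\<in>I. x i > 0 \<and> y i > 0 \<and> ln (real (max (x i) (y i))) \<le> log_mahler (w i))"
proof -
  have "\<forall>i\<in>I. \<exists>x y. x > 0 \<and> y > 0 \<and> algebraic_int (of_nat x / w i) \<and> algebraic_int (of_nat y * w i)
     \<and> ln (real (max x y)) \<le> log_mahler (w i)"
    using assms(2) ex_nat_bounds_log_mahler by blast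
  then obtain x0 y0 where xy0: "\<And>i. i \<in> I \<Longrightarrow> x0 i > 0 \<and> y0 i > 0 \<and>
     algebraic_int (of_nat (x0 i) / w i) \<and> algebraic_int (of_nat (y0 i) * w i)
     \<and> ln (real (max (x0 i) (y0 i))) \<le> log_mahler (w i)"
    by metis
  have "B dvd prod y0 I"
    using xy0 assms by (intro prod_scaled_algebraic_int_dvd[of I y0 w A B]) auto
  \<comment> \<open>The same argument for the reciprocals, where numerator and denominator exchange
    roles.\<close>
  moreover have "A dvd prod x0 I"
  proof (rule prod_scaled_algebraic_int_dvd[of I x0 "\<lambda>i. inverse (w i)" B A])
    show "(\<Prod>i\<in>I. inverse (w i)) = of_nat B / of_nat A"
      using assms(3) prod_inversef[of w I] by (simp add: o_def)
  qed (use xy0 assms in \<open>auto simp: Rings.coprime_commute divide_inverse\<close>)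
  ultimately obtain x y where x: "\<forall>i\<in>I. x i dvd x0 i" "prod x I = A"
      and y: "\<forall>i\<in>I. y i dvd y0 i" "prod y I = B"
    using dvd_prod_decomp[OF assms(1), of A x0] dvd_prod_decomp[OF assms(1), of B y0] by blast
  have "x i > 0 \<and> y i > 0 \<and> ln (real (max (x i) (y i))) \<le> log_mahler (w i)" if i: "i \<in> I" for i
  proof -
    have "x i > 0" "y i > 0" using x(1) y(1) xy0[OF i] i by (auto intro!: Nat.gr0I)
    moreover have "x i \<le> x0 i" "y i \<le> y0 i" using x(1) y(1) xy0[OF i] i by (auto intro: dvd_imp_le)
    hence "ln (real (max (x i) (y i))) \<le> ln (real (max (x0 i) (y0 i)))"
      using \<open>x i > 0\<close> by (subst ln_le_cancel_iff) auto
    ultimately show ?thesis using xy0[OF i] by linarith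
  qed
  thus ?thesis using x y by blast
qed

section \<open>Upper bounds for, and attainment of, the infimum\<close>

lemma metric_mahler_le:
  fixes M :: nat
  assumes "\<forall>n\<in>{1..M}. algebraic (w n) \<and> w n \<noteq> 0" "z = (\<Prod>n=1..M. w n)"
  shows "metric_mahler t z \<le> (\<Sum>n=1..M. log_mahler (w n) powr t) powr (1 / t)"
  unfolding metric_mahler_def
proof (rule cInf_lower)
  show "bdd_below {(\<Sum>n=1..M. log_mahler (w n) powr t) powr (1 / t) | (M :: nat) w.
            (\<forall>n\<in>{1..M}. algebraic (w n) \<and> w n \<noteq> 0) \<and> z = (\<Prod>n=1..M. w n)}"
    by (rule bdd_belowI[of _ 0]) auto
qed (intro CollectI exI[of _ M] exI[of _ w] conjI refl assms)

lemma metric_mahler_eqI: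
  fixes M :: nat
  assumes "t > 0" "\<forall>n\<in>{1..M}. algebraic (w n) \<and> w n \<noteq> 0" "z = (\<Prod>n=1..M. w n)"
    and "(\<Sum>n=1..M. log_mahler (w n) powr t) = c"
    and "\<And>(M::nat) w. \<lbrakk>\<forall>n\<in>{1..M}. algebraic (w n) \<and> w n \<noteq> 0; z = (\<Prod>n=1..M. w n)\<rbrakk>
           \<Longrightarrow> c \<le> (\<Sum>n=1..M. log_mahler (w n) powr t)"
  shows "metric_mahler t z = c powr (1 / t)"
  unfolding metric_mahler_def
proof (rule cInf_eq_minimum)
  show "c powr (1 / t) \<in> {(\<Sum>n=1..M. log_mahler (w n) powr t) powr (1 / t) | (M :: nat) w.
            (\<forall>n\<in>{1..M}. algebraic (w n) \<and> w n \<noteq> 0) \<and> z = (\<Prod>n=1..M. w n)}"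
    unfolding assms(4)[symmetric]
    by (intro CollectI exI[of _ M] exI[of _ w] conjI refl assms(2,3))
  have "c \<ge> 0" using assms(4) by (auto intro: sum_nonneg)
  fix s assume "s \<in> {(\<Sum>n=1..M. log_mahler (w n) powr t) powr (1 / t) | (M :: nat) w.
            (\<forall>n\<in>{1..M}. algebraic (w n) \<and> w n \<noteq> 0) \<and> z = (\<Prod>n=1..M. w n)}"
  then obtain M :: nat and w where s: "s = (\<Sum>n=1..M. log_mahler (w n) powr t) powr (1 / t)"
    and w: "\<forall>n\<in>{1..M}. algebraic (w n) \<and> w n \<noteq> 0" "z = (\<Prod>n=1..M. w n)" by blast
  show "c powr (1 / t) \<le> s"
    unfolding s using assms(1) \<open>c \<ge> 0\<close> assms(5)[OF w] by (intro powr_mono2) simp_all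
qed

section \<open>Comparison of logarithmic power sums for large exponents\<close>

definition log_pow_sum :: "real \<Rightarrow> nat multiset \<Rightarrow> real" where
  "log_pow_sum t V = (\<Sum>v\<in>#V. ln (real v) powr t)"

lemma log_pow_sum_simps [simp]:
  "log_pow_sum t {#} = 0"
  "log_pow_sum t (add_mset v V) = ln (real v) powr t + log_pow_sum t V"
  "log_pow_sum t (V + W) = log_pow_sum t V + log_pow_sum t W"
  by (simp_all add: log_pow_sum_def)

lemma log_pow_sum_nonneg [simp]: "log_pow_sum t V \<ge> 0"
  by (induction V) auto

lemma log_powr_le_log_pow_sum: "v \<in># V \<Longrightarrow> ln (real v) powr t \<le> log_pow_sum t V"
  by (auto dest!: multi_member_split)

lemma tendsto_powr_at_top_0:
  assumes "0 \<le> r" "r < (1::real)"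
  shows "((\<lambda>t. r powr t) \<longlongrightarrow> 0) at_top"
proof (cases "r = 0")
  case False
  hence "((\<lambda>t. exp (ln r * t)) \<longlongrightarrow> 0) at_top"
    using assms
    by (intro filterlim_compose[OF exp_at_bot]
        filterlim_tendsto_neg_mult_at_bot[OF tendsto_const _ filterlim_ident]) auto
  thus ?thesis using False by (simp add: powr_def mult.commute)
qed simp

text \<open>Each ratio (ln v / ln u)^t tends to 0, and there are finitely many of them.\<close>

lemma eventually_log_pow_sum_less:
  assumes "u \<ge> 2" "\<And>v. v \<in># V \<Longrightarrow> v < u"
  shows "\<forall>\<^sub>F t in at_top. log_pow_sum t V < ln (real u) powr t"
proof -
  have "((\<lambda>t. log_pow_sum t V / ln (real u) powr t) \<longlongrightarrow> 0) at_top"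
    using assms(2)
  proof (induction V)
    case (add v V)
    have "v < u" using add.prems by simp
    \<comment> \<open>The entry 0 may occur here and is covered by the convention
      \<open>ln 0 = 0\<close>.\<close>
    hence "0 \<le> ln (real v) / ln (real u)" "ln (real v) / ln (real u) < 1"
      using assms(1) by (cases "v = 0"; simp add: field_simps)+
    from tendsto_powr_at_top_0[OF this] have "((\<lambda>t. ln (real v) powr t / ln (real u) powr t) \<longlongrightarrow> 0) at_top"
      using assms(1) by (cases "v = 0") (simp_all add: powr_divide)
    from tendsto_add[OF this add.IH] add.prems show ?case by (simp add: add_divide_distrib)
  qed simp
  hence "\<forall>\<^sub>F t in at_top. log_pow_sum t V / ln (real u) powr t < 1"
    by (rule order_tendstoD) simp
  thus ?thesis
  proof eventually_elim
    case (elim t)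
    thus ?case using assms(1) by (simp add: divide_less_eq)
  qed
qed

text \<open>
  Induction cancelling the maximum of \<open>U\<close> from both sides: at the first place where the two
  multisets differ, the larger element decides, and \<open>Q\<close> only has elements below it.
\<close>
lemma eventually_log_pow_sum_add_less:
  assumes "\<And>u. u \<in># U \<Longrightarrow> u \<ge> 2" "\<And>q u. q \<in># Q \<Longrightarrow> u \<in># U \<Longrightarrow> q < u"
  shows "\<forall>\<^sub>F t in at_top. log_pow_sum t V < log_pow_sum t U \<longrightarrow>
           log_pow_sum t V + log_pow_sum t Q < log_pow_sum t U"
  using assms
proof (induction "size V" arbitrary: U V rule: less_induct)
  case less
  show ?case
  proof (cases "U = {#}")
    case True
    thus ?thesis by (simp add: leD)
  next
    case False
    define u where "u = Max_mset U"
    have u: "u \<in># U" "\<And>u'. u' \<in># U \<Longrightarrow> u' \<le> u"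
      using False by (auto simp: u_def)
    consider "\<forall>v\<in>#V. v < u" | "u \<in># V" | v where "v \<in># V" "v > u"
      by (metis linorder_neqE_nat)
    thus ?thesis
    proof cases
      \<comment> \<open>The single element \<open>u\<close> eventually outweighs \<open>V\<close>
        and \<open>Q\<close> together.\<close>
      case 1
      have "\<forall>\<^sub>F t in at_top. log_pow_sum t (V + Q) < ln (real u) powr t"
        using 1 u less.prems by (intro eventually_log_pow_sum_less) auto
      thus ?thesis
        by eventually_elim (use log_powr_le_log_pow_sum[OF u(1)] in \<open>force intro: less_le_trans\<close>)
    next
      \<comment> \<open>Cancelling \<open>u\<close> preserves both inequalities and decreases the
        size of \<open>V\<close>.\<close>
      case 2
      then obtain V' U' where V': "V = add_mset u V'" "U = add_mset u U'"
        using u(1) by (metis multi_member_split)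
      have "\<forall>\<^sub>F t in at_top. log_pow_sum t V' < log_pow_sum t U' \<longrightarrow>
           log_pow_sum t V' + log_pow_sum t Q < log_pow_sum t U'"
        by (rule less.hyps) (use less.prems in \<open>auto simp: V'\<close>)
      thus ?thesis by eventually_elim (simp add: V')
    next
      \<comment> \<open>One element of \<open>V\<close> eventually outweighs all of
        \<open>U\<close>, so the premise of the implication fails.\<close>
      case 3
      have "\<forall>\<^sub>F t in at_top. log_pow_sum t U < ln (real v) powr t"
        using 3 u less.prems(1)[OF u(1)] by (intro eventually_log_pow_sum_less) (auto intro: le_less_trans)
      thus ?thesis
        by eventually_elim (use log_powr_le_log_pow_sum[OF 3(1)] in \<open>smt (verit)\<close>)
    qed
  qed
qed

lemma finite_bounded_msets: "finite {V :: nat multiset. set_mset V \<subseteq> {..C} \<and> size V \<le> C}"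
proof (rule finite_subset)
  show "{V :: nat multiset. set_mset V \<subseteq> {..C} \<and> size V \<le> C}
      \<subseteq> mset ` {xs. set xs \<subseteq> {..C} \<and> length xs \<le> C}"
  proof
    fix V :: "nat multiset" assume V: "V \<in> {V. set_mset V \<subseteq> {..C} \<and> size V \<le> C}"
    obtain xs where "V = mset xs" by (metis ex_mset)
    thus "V \<in> mset ` {xs. set xs \<subseteq> {..C} \<and> length xs \<le> C}" using V by auto
  qed
qed (intro finite_imageI finite_lists_length_le finite_atMost)

text \<open>
  Only finitely many multisets of integers \<open>\<ge> 2\<close> have product at most \<open>C\<close>, so the threshold for
  \<open>t\<close> can be chosen uniformly.
\<close>
lemma eventually_log_sum_append_less:
  assumes "\<And>u. u \<in># U \<Longrightarrow> u \<ge> 2" "\<And>q u. q \<in># Q \<Longrightarrow> u \<in># U \<Longrightarrow> q < u"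
  shows "\<forall>\<^sub>F t in at_top. \<forall>I (z :: nat \<Rightarrow> nat). finite I \<longrightarrow> (\<forall>j\<in>I. z j > 0) \<longrightarrow> prod z I \<le> C \<longrightarrow>
           (\<Sum>j\<in>I. ln (real (z j)) powr t) < log_pow_sum t U \<longrightarrow>
           (\<Sum>j\<in>I. ln (real (z j)) powr t) + log_pow_sum t Q < log_pow_sum t U"
proof -
  \<comment> \<open>This set depends only on \<open>C\<close>; being finite, it has one threshold
    that serves every \<open>I\<close> and \<open>z\<close>.\<close>
  let ?F = "{V :: nat multiset. set_mset V \<subseteq> {..C} \<and> size V \<le> C}"
  have "\<forall>\<^sub>F t in at_top. \<forall>V\<in>?F. log_pow_sum t V < log_pow_sum t U \<longrightarrow>
           log_pow_sum t V + log_pow_sum t Q < log_pow_sum t U"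
    by (intro eventually_ball_finite finite_bounded_msets ballI eventually_log_pow_sum_add_less assms)
  thus ?thesis
  proof eventually_elim
    case (elim t)
    show ?case
    proof (intro allI impI)
      fix I and z :: "nat \<Rightarrow> nat"
      assume I: "finite I" "\<forall>j\<in>I. z j > 0" "prod z I \<le> C"
        and less: "(\<Sum>j\<in>I. ln (real (z j)) powr t) < log_pow_sum t U"
      \<comment> \<open>Entries equal to 1 cost nothing but can be arbitrarily many; discarding them
        bounds the size of \<open>V\<close>.\<close>
      define J where "J = {j\<in>I. z j \<ge> 2}"
      define V where "V = image_mset z (mset_set J)"
      have J: "finite J" "J \<subseteq> I" using I by (auto simp: J_def)
      have "log_pow_sum t V = (\<Sum>j\<in>J. ln (real (z j)) powr t)"
        by (simp add: V_def log_pow_sum_def sum_unfold_sum_mset multiset.map_comp o_def)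
      also have "\<dots> = (\<Sum>j\<in>I. ln (real (z j)) powr t)"
      proof (rule sum.mono_neutral_left)
        show "\<forall>i\<in>I - J. ln (real (z i)) powr t = 0"
        proof
          fix i assume "i \<in> I - J"
          hence "z i = 1" using I(2) by (force simp: J_def)
          thus "ln (real (z i)) powr t = 0" by simp
        qed
      qed (use I J in auto)
      finally have sumV: "log_pow_sum t V = (\<Sum>j\<in>I. ln (real (z j)) powr t)" .
      have pos: "prod z I > 0" using I by (intro prod_pos) auto
      have "z j \<le> C" if "j \<in> J" for j
        using that J I pos dvd_prodI[of I j z] by (meson dvd_imp_le le_trans subsetD)
      \<comment> \<open>Each remaining factor is at least 2, so \<open>2 ^ card J\<close> is at most
        the product.\<close>
      moreover have "card J \<le> C"
      proof -
        have "card J < 2 ^ card J" by (rule less_exp)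
        also have "2 ^ card J = (\<Prod>j\<in>J. 2)" by simp
        also have "\<dots> \<le> prod z J" by (intro prod_mono) (auto simp: J_def)
        also have "\<dots> \<le> prod z I" using pos I J by (intro dvd_imp_le prod_dvd_prod_subset) auto
        finally show ?thesis using I by simp
      qed
      ultimately have "V \<in> ?F" using J by (auto simp: V_def)
      thus "(\<Sum>j\<in>I. ln (real (z j)) powr t) + log_pow_sum t Q < log_pow_sum t U"
        using elim less sumV by metis
    qed
  qed
qed

section \<open>Numerators and denominators of partial products\<close>

lemma quotient_of_nat_div:
  assumes "Rings.coprime a b" "b > 0"
  shows "quotient_of (of_nat a / of_nat b) = (int a, int b)"
proof -
  have "quotient_of (Rat.Fract (int a) (int b)) = (int a, int b)"
    using assms by (simp add: quotient_of_Fract Rat.normalize_stable)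
  thus ?thesis by (simp add: Fract_of_int_quotient)
qed

lemma nat_fraction_eqD:
  assumes "(of_nat a / of_nat b :: rat) = of_nat c / of_nat d"
    and "Rings.coprime a b" "b > 0" "Rings.coprime c d" "d > 0"
  shows "a = c \<and> b = d"
proof -
  have "(int a, int b) = (int c, int d)"
    using quotient_of_nat_div[OF assms(2,3)] quotient_of_nat_div[OF assms(4,5)]
    unfolding assms(1) by (rule trans[OF sym])
  thus ?thesis by simp
qed

text \<open>Absolute value 1 means that p has the same exponent in \<open>a\<close> and
  \<open>b\<close>; coprimality forces that exponent to be 0.\<close>

lemma padic_abs_eq_1_imp_not_dvd:
  assumes "Rings.coprime a b" "a > 0" "b > 0" "Factorial_Ring.prime p" "padic_abs p (of_nat a / of_nat b) = 1"
  shows "\<not> p dvd a \<and> \<not> p dvd b"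
proof -
  have p: "real p > 1" using assms(4) prime_gt_1_nat by auto
  have val: "padic_valuation p (of_nat a / of_nat b) =
      int (multiplicity (int p) (int a)) - int (multiplicity (int p) (int b))"
    using assms by (simp add: padic_valuation_def quotient_of_nat_div)
  have "padic_valuation p (of_nat a / of_nat b) = 0"
  proof (rule ccontr)
    let ?v = "- padic_valuation p (of_nat a / of_nat b)"
    assume "padic_valuation p (of_nat a / of_nat b) \<noteq> 0"
    hence "?v < 0 \<or> 0 < ?v" by linarith
    hence "real p powi ?v \<noteq> 1"
      using power_int_strict_increasing[of ?v 0 "real p"] power_int_strict_increasing[of 0 ?v "real p"] p
      by auto
    thus False using assms(2,3,5) by (simp add: padic_abs_def)
  qed
  with val have "multiplicity (int p) (int a) = multiplicity (int p) (int b)" by simp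
  moreover have "multiplicity (int p) (int c) > 0 \<longleftrightarrow> p dvd c" if "c > 0" for c
    using that p by (subst multiplicity_gt_zero_iff) auto
  ultimately have "p dvd a \<longleftrightarrow> p dvd b" using assms(2,3) by metis
  thus ?thesis using assms(1,4) by (metis Rings.coprime_common_divisor not_prime_unit)
qed

text \<open>Arbitrary index sets let the same facts serve the partial products, with indices
  \<open>{1..n}\<close>, and their quotients, with indices \<open>{n+1..m}\<close>.\<close>

definition num_on :: "rat \<Rightarrow> nat set \<Rightarrow> nat" where
  "num_on \<alpha> I = (\<Prod>i\<in>{i\<in>I. nth_prime \<alpha> i dvd numer \<alpha>}. nth_prime \<alpha> i)"

definition den_on :: "rat \<Rightarrow> nat set \<Rightarrow> nat" where
  "den_on \<alpha> I = (\<Prod>i\<in>{i\<in>I. \<not> nth_prime \<alpha> i dvd numer \<alpha>}. nth_prime \<alpha> i)"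

context
  fixes \<alpha> :: rat
  assumes pos: "\<alpha> > 0"
begin

section \<open>Numerator, denominator and prime list of \<alpha>\<close>

lemma numer_denom: "numer \<alpha> > 0" "denom \<alpha> > 0" "Rings.coprime (numer \<alpha>) (denom \<alpha>)"
    "\<alpha> = of_nat (numer \<alpha>) / of_nat (denom \<alpha>)"
proof -
  obtain a b where ab: "quotient_of \<alpha> = (a, b)" by force
  note b = quotient_of_denom_pos[OF ab]
  note \<alpha> = quotient_of_div[OF ab]
  have a: "a > 0" using pos b unfolding \<alpha> by (simp add: zero_less_divide_iff)
  have nd: "numer \<alpha> = nat a" "denom \<alpha> = nat b" by (simp_all add: numer_def denom_def ab)
  have "Rings.coprime (int (nat a)) (int (nat b))" using a b quotient_of_coprime[OF ab] by simp
  thus "Rings.coprime (numer \<alpha>) (denom \<alpha>)" unfolding nd coprime_int_iff .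
  show "numer \<alpha> > 0" "denom \<alpha> > 0" using a b by (simp_all add: nd)
  show "\<alpha> = of_nat (numer \<alpha>) / of_nat (denom \<alpha>)"
    unfolding nd using a b by (subst \<alpha>) simp
qed

lemma nth_prime_mem:
  assumes "i \<in> {1..nprimes \<alpha>}"
  shows "Factorial_Ring.prime (nth_prime \<alpha> i)" "nth_prime \<alpha> i dvd numer \<alpha> * denom \<alpha>"
proof -
  have "nth_prime \<alpha> i \<in> set (prime_list \<alpha>)"
    using assms by (auto simp: nth_prime_def nprimes_def intro!: nth_mem)
  hence "nth_prime \<alpha> i \<in># prime_factorization (numer \<alpha> * denom \<alpha>)"
    by (simp add: prime_list_def)
  thus "Factorial_Ring.prime (nth_prime \<alpha> i)" "nth_prime \<alpha> i dvd numer \<alpha> * denom \<alpha>"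
    by (auto simp: in_prime_factors_iff)
qed

lemma nth_prime_antimono:
  assumes "1 \<le> i" "i \<le> j" "j \<le> nprimes \<alpha>"
  shows "nth_prime \<alpha> j \<le> nth_prime \<alpha> i"
proof -
  have "sorted (rev (prime_list \<alpha>))" by (simp add: prime_list_def)
  thus ?thesis using assms
    by (auto simp: nth_prime_def nprimes_def sorted_rev_iff_nth_mono)
qed

lemma prod_nth_prime: "(\<Prod>i\<in>{1..nprimes \<alpha>}. nth_prime \<alpha> i) = numer \<alpha> * denom \<alpha>"
proof -
  have "(\<Prod>i\<in>{1..nprimes \<alpha>}. nth_prime \<alpha> i) = (\<Prod>i<nprimes \<alpha>. prime_list \<alpha> ! i)"
    by (rule prod.reindex_bij_witness[of _ Suc "\<lambda>i. i - 1"]) (auto simp: nth_prime_def)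
  also have "\<dots> = prod_list (prime_list \<alpha>)"
    by (simp add: nprimes_def prod.list_conv_set_nth lessThan_atLeast0)
  also have "\<dots> = prod_mset (prime_factorization (numer \<alpha> * denom \<alpha>))"
    by (simp add: prime_list_def flip: prod_mset_prod_list)
  also have "\<dots> = numer \<alpha> * denom \<alpha>"
    using numer_denom by (intro prod_mset_prime_factorization_nat) simp
  finally show ?thesis .
qed

context
  fixes I :: "nat set"
  assumes I: "I \<subseteq> {1..nprimes \<alpha>}"
begin

section \<open>Signed prime products over an index set\<close>

lemma finite_index: "finite I"
  using I finite_subset by blast

lemma num_den_pos: "num_on \<alpha> I > 0" "den_on \<alpha> I > 0"
  unfolding num_on_def den_on_def using I nth_prime_mem(1) prime_gt_0_nat by (auto intro!: prod_pos)

lemma prime_not_dvd_numer_imp: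
  assumes "i \<in> I" "\<not> nth_prime \<alpha> i dvd numer \<alpha>"
  shows "Rings.coprime (numer \<alpha>) (nth_prime \<alpha> i)"
  using assms I nth_prime_mem(1) by (metis Rings.coprime_commute prime_imp_coprime subsetD)

lemma prime_dvd_numer_imp:
  assumes "nth_prime \<alpha> i dvd numer \<alpha>"
  shows "Rings.coprime (nth_prime \<alpha> i) (denom \<alpha>)"
  using assms numer_denom(3) Rings.coprime_divisors[OF assms dvd_refl] by blast

lemma coprime_num_denom: "Rings.coprime (num_on \<alpha> I) (denom \<alpha>)"
  unfolding num_on_def by (intro prod_coprime_left prime_dvd_numer_imp) auto

lemma coprime_numer_den: "Rings.coprime (numer \<alpha>) (den_on \<alpha> I)"
  unfolding den_on_def by (intro prod_coprime_right prime_not_dvd_numer_imp) auto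

lemma coprime_num_den: "Rings.coprime (num_on \<alpha> I) (den_on \<alpha> I)"
  unfolding num_on_def den_on_def
proof (intro prod_coprime_left prod_coprime_right)
  fix i j assume "i \<in> {i\<in>I. nth_prime \<alpha> i dvd numer \<alpha>}" "j \<in> {i\<in>I. \<not> nth_prime \<alpha> i dvd numer \<alpha>}"
  hence "Rings.coprime (numer \<alpha>) (nth_prime \<alpha> j)" "nth_prime \<alpha> i dvd numer \<alpha>"
    using prime_not_dvd_numer_imp by auto
  thus "Rings.coprime (nth_prime \<alpha> i) (nth_prime \<alpha> j)"
    using Rings.coprime_divisors[OF _ dvd_refl] by blast
qed

lemma num_mult_den: "num_on \<alpha> I * den_on \<alpha> I = prod (nth_prime \<alpha>) I"
  unfolding num_on_def den_on_def using finite_index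
  by (subst prod.union_disjoint[symmetric]) (auto intro!: prod.cong)

lemma prod_signed_primes:
  "(\<Prod>i\<in>I. of_nat (nth_prime \<alpha> i) powi gamma_sign \<alpha> i :: rat) = of_nat (num_on \<alpha> I) / of_nat (den_on \<alpha> I)"
proof -
  have "(\<Prod>i\<in>I. of_nat (nth_prime \<alpha> i) powi gamma_sign \<alpha> i :: rat)
     = (\<Prod>i\<in>{i\<in>I. nth_prime \<alpha> i dvd numer \<alpha>}. of_nat (nth_prime \<alpha> i)) *
       (\<Prod>i\<in>{i\<in>I. \<not> nth_prime \<alpha> i dvd numer \<alpha>}. inverse (of_nat (nth_prime \<alpha> i)))"
  proof -
    have "(\<Prod>i\<in>I. of_nat (nth_prime \<alpha> i) powi gamma_sign \<alpha> i :: rat)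
       = (\<Prod>i\<in>I. if nth_prime \<alpha> i dvd numer \<alpha> then of_nat (nth_prime \<alpha> i) else inverse (of_nat (nth_prime \<alpha> i)))"
      by (intro prod.cong) (auto simp: gamma_sign_def power_int_minus)
    thus ?thesis using finite_index by (simp add: prod.If_cases Int_def)
  qed
  thus ?thesis
    by (simp add: num_on_def den_on_def divide_inverse prod_inversef[symmetric] o_def)
qed

text \<open>No prime of the product can cancel, because its numerator and denominator are
  coprime.\<close>

lemma padic_abs_eq_1_imp_notin:
  assumes "Factorial_Ring.prime p" "padic_abs p (\<Prod>i\<in>I. of_nat (nth_prime \<alpha> i) powi gamma_sign \<alpha> i) = 1" "i \<in> I"
  shows "nth_prime \<alpha> i \<noteq> p"
proof
  assume p: "nth_prime \<alpha> i = p"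
  have "\<not> p dvd num_on \<alpha> I \<and> \<not> p dvd den_on \<alpha> I"
    using assms coprime_num_den num_den_pos
    by (intro padic_abs_eq_1_imp_not_dvd) (auto simp: prod_signed_primes)
  moreover have "p dvd num_on \<alpha> I * den_on \<alpha> I"
    unfolding num_mult_den using assms(3) finite_index p by (metis dvd_prodI)
  ultimately show False using assms(1) by (metis prime_dvd_mult_iff)
qed

end

lemma partial_rat_altdef:
  assumes "n \<le> nprimes \<alpha>"
  shows "partial_rat \<alpha> n = of_nat (num_on \<alpha> {1..n}) / of_nat (den_on \<alpha> {1..n})"
  unfolding partial_rat_def using assms by (intro prod_signed_primes) auto

lemma partial_rat_split:
  assumes "n \<le> m"
  shows "partial_rat \<alpha> m = partial_rat \<alpha> n * (\<Prod>i\<in>{n+1..m}. of_nat (nth_prime \<alpha> i) powi gamma_sign \<alpha> i)"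
proof -
  have "{1..m} = {1..n} \<union> {n+1..m}" using assms by auto
  thus ?thesis unfolding partial_rat_def by (simp add: prod.union_disjoint)
qed

lemma partial_rat_pos: "n \<le> nprimes \<alpha> \<Longrightarrow> partial_rat \<alpha> n > 0"
  using num_den_pos[of "{1..n}"] by (simp add: partial_rat_altdef)

text \<open>The two fractions have equal products of numerator and denominator, and each numerator
  is coprime to the other denominator; this forces equality of both parts.\<close>

lemma partial_rat_nprimes: "partial_rat \<alpha> (nprimes \<alpha>) = \<alpha>"
proof -
  let ?A = "num_on \<alpha> {1..nprimes \<alpha>}" and ?B = "den_on \<alpha> {1..nprimes \<alpha>}"
  have "?A * ?B = numer \<alpha> * denom \<alpha>"
    using num_mult_den[OF order_refl] prod_nth_prime by simp
  hence "?A = numer \<alpha> \<and> ?B = denom \<alpha>"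
    using coprime_num_denom[OF order_refl] coprime_numer_den[OF order_refl]
      coprime_crossproduct_nat[of ?A "denom \<alpha>" "numer \<alpha>" ?B] by (simp add: mult.commute Rings.coprime_commute)
  thus ?thesis using numer_denom(4) by (simp add: partial_rat_altdef)
qed

text \<open>The prime at \<open>j\<close> occurs in \<alpha> / \<alpha>_n, so separation excludes it
  from \<alpha>_n; the decreasing order of the list then becomes strict.\<close>

lemma separation_index_less:
  assumes "separation_index \<alpha> n" "i \<in> {1..n}" "j \<in> {n+1..nprimes \<alpha>}"
  shows "nth_prime \<alpha> j < nth_prime \<alpha> i"
proof -
  define p where "p = nth_prime \<alpha> j"
  have n: "n \<le> nprimes \<alpha>" using assms(1) by (simp add: separation_index_def)
  have p: "Factorial_Ring.prime p" using nth_prime_mem(1) assms(3) by (auto simp: p_def)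
  have "\<alpha> / partial_rat \<alpha> n = (\<Prod>i\<in>{n+1..nprimes \<alpha>}. of_nat (nth_prime \<alpha> i) powi gamma_sign \<alpha> i)"
    using partial_rat_split[OF n] partial_rat_nprimes partial_rat_pos[OF n] by (simp add: field_simps)
  moreover have "padic_abs p (partial_rat \<alpha> n) = 1 \<or> padic_abs p (\<alpha> / partial_rat \<alpha> n) = 1"
    using assms(1) p by (simp add: separation_index_def)
  ultimately have "nth_prime \<alpha> i \<noteq> p"
    using padic_abs_eq_1_imp_notin[of "{1..n}" p i] padic_abs_eq_1_imp_notin[of "{n+1..nprimes \<alpha>}" p j]
      assms(2,3) n p by (auto simp: partial_rat_def p_def)
  thus ?thesis using nth_prime_antimono[of i j] assms(2,3) n by (auto simp: p_def le_less)
qed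

text \<open>If two indices gave the same value, the signed primes between them would multiply to 1,
  but nothing cancels there. Hence a factorization determines the index to which it belongs.\<close>

lemma partial_rat_inj:
  assumes "partial_rat \<alpha> n = partial_rat \<alpha> m" "n \<le> nprimes \<alpha>" "m \<le> nprimes \<alpha>"
  shows "n = m"
proof -
  have False if nm: "n < m" "m \<le> nprimes \<alpha>" and eq: "partial_rat \<alpha> n = partial_rat \<alpha> m" for n m
  proof -
    let ?I = "{n+1..m}"
    have I: "?I \<subseteq> {1..nprimes \<alpha>}" using nm by auto
    have "(\<Prod>i\<in>?I. of_nat (nth_prime \<alpha> i) powi gamma_sign \<alpha> i :: rat) = 1"
      using partial_rat_split[of n m] partial_rat_pos[of n] nm eq by auto
    hence "(of_nat (num_on \<alpha> ?I) / of_nat (den_on \<alpha> ?I) :: rat) = of_nat 1 / of_nat 1"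
      by (simp only: prod_signed_primes[OF I] of_nat_1 div_by_1)
    from nat_fraction_eqD[OF this] have "num_on \<alpha> ?I = 1 \<and> den_on \<alpha> ?I = 1"
      using coprime_num_den[OF I] num_den_pos[OF I] by simp
    hence "prod (nth_prime \<alpha>) ?I = 1" using num_mult_den[OF I] by (metis mult_1)
    moreover have "nth_prime \<alpha> m dvd prod (nth_prime \<alpha>) ?I" using nm by (intro dvd_prodI) auto
    ultimately have "nth_prime \<alpha> m = 1" by simp
    thus False using nth_prime_mem(1)[of m] nm by simp
  qed
  thus ?thesis using assms by (metis linorder_neqE_nat)
qed

end

section \<open>Factorizations along a branch of the tree\<close>

text \<open>For a factorization this is the Mahler measure of the \<open>i\<close>-th fraction,
  which is in lowest terms.\<close>

definition slot :: "fact_seq \<Rightarrow> nat \<Rightarrow> nat" where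
  "slot f i = max (top_of f i) (bot_of f i)"

definition nontrivial :: "fact_seq \<Rightarrow> nat set" where
  "nontrivial f = {i. f i \<noteq> (1, 1)}"

lemma factorization_facts:
  assumes "factorization \<beta> f"
  shows "top_of f i > 0" "bot_of f i > 0" "Rings.coprime (top_of f i) (bot_of f j)" "finite (nontrivial f)"
  using assms by (auto simp: factorization_def nontrivial_def coprime_iff_gcd_eq_1)

lemma factorization_value:
  assumes "factorization \<beta> f" "finite S" "nontrivial f \<subseteq> S"
  shows "(\<Prod>i\<in>S. of_nat (top_of f i) / of_nat (bot_of f i)) = \<beta>"
proof -
  have "(\<Prod>i\<in>S. of_nat (top_of f i) / of_nat (bot_of f i) :: rat)
      = (\<Prod>i\<in>nontrivial f. of_nat (top_of f i) / of_nat (bot_of f i))"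
    by (rule prod.mono_neutral_right) (use assms in \<open>auto simp: nontrivial_def\<close>)
  thus ?thesis using assms(1) by (simp add: factorization_def nontrivial_def)
qed

lemma factorization_unique:
  assumes "factorization \<beta> f" "factorization \<beta>' f"
  shows "\<beta> = \<beta>'"
  using assms by (simp add: factorization_def)

text \<open>Every numerator is coprime to every denominator, so the product of the fractions is
  already in lowest terms.\<close>

lemma factorization_prods:
  assumes "factorization (of_nat A / of_nat B) f" "Rings.coprime A B" "B > 0"
  shows "(\<Prod>i\<in>nontrivial f. top_of f i) = A \<and> (\<Prod>i\<in>nontrivial f. bot_of f i) = B"
proof (rule nat_fraction_eqD)
  show "(of_nat (\<Prod>i\<in>nontrivial f. top_of f i) / of_nat (\<Prod>i\<in>nontrivial f. bot_of f i) :: rat)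
      = of_nat A / of_nat B"
    using factorization_value[OF assms(1) factorization_facts(4)[OF assms(1)] order_refl]
    by (simp add: prod_dividef)
  show "Rings.coprime (\<Prod>i\<in>nontrivial f. top_of f i) (\<Prod>i\<in>nontrivial f. bot_of f i)"
    by (intro prod_coprime_left prod_coprime_right factorization_facts[OF assms(1)])
  show "(\<Prod>i\<in>nontrivial f. bot_of f i) > 0"
    by (intro prod_pos ballI factorization_facts[OF assms(1)])
qed (use assms in auto)

lemma log_mahler_slot:
  assumes "factorization \<beta> f"
  shows "log_mahler (of_nat (top_of f i) / of_nat (bot_of f i)) = ln (real (slot f i))"
  unfolding slot_def using factorization_facts[OF assms] by (intro log_mahler_of_rat)

lemma slot_trivial: "i \<notin> nontrivial f \<Longrightarrow> slot f i = 1"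
  by (simp add: nontrivial_def slot_def)

lemma slot_nontrivial:
  assumes "factorization \<beta> f" "i \<in> nontrivial f"
  shows "slot f i \<ge> 2"
proof -
  have "top_of f i \<noteq> 1 \<or> bot_of f i \<noteq> 1" using assms(2) by (auto simp: nontrivial_def prod_eq_iff)
  thus ?thesis using factorization_facts(1,2)[OF assms(1), of i] by (auto simp: slot_def)
qed

lemma sum_slot_eq:
  assumes "finite S" "nontrivial f \<subseteq> S"
  shows "(\<Sum>i\<in>S. ln (real (slot f i)) powr t) = (\<Sum>i\<in>nontrivial f. ln (real (slot f i)) powr t)"
  by (rule sum.mono_neutral_right) (use assms in \<open>auto simp: slot_trivial\<close>)

lemma suminf_slot:
  assumes "factorization \<beta> f"
  shows "(\<Sum>i. log_mahler (of_nat (top_of f i) / of_nat (bot_of f i)) powr t)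
       = (\<Sum>i\<in>nontrivial f. ln (real (slot f i)) powr t)"
  unfolding log_mahler_slot[OF assms]
  by (rule suminf_finite) (use assms in \<open>auto simp: slot_trivial factorization_facts\<close>)

lemma direct_subfactorization_slot_mono:
  assumes "direct_subfactorization \<alpha> n f g"
  shows "slot f i \<le> slot g i"
proof -
  have "top_of g i > 0" "bot_of g i > 0" for i
    using assms factorization_facts[of _ g] unfolding direct_subfactorization_def by blast+
  hence nz: "top_of g i \<noteq> 0" "bot_of g i \<noteq> 0" for i by (simp_all add: neq0_conv)
  from assms have "top_of f i dvd top_of g i \<and> bot_of f i dvd bot_of g i"
    unfolding direct_subfactorization_def by (metis dvd_refl dvd_triv_left)
  hence "top_of f i \<le> top_of g i" "bot_of f i \<le> bot_of g i"
    using nz by (auto intro!: dvd_imp_le)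
  thus ?thesis by (auto simp: slot_def)
qed

text \<open>Induction along the branch from \<open>s\<close> down to \<open>r\<close>: each edge
  raises the index by one and multiplies a single numerator or denominator, so no entry
  shrinks.\<close>

lemma descendant_factorization:
  assumes "\<alpha> > 0" "factorization_tree \<alpha> T \<nu>" "(r, s) \<in> (parent_rel T)\<^sup>*"
    and "factorization (partial_rat \<alpha> n) (\<nu> s)" "n \<le> nprimes \<alpha>"
  shows "\<exists>m. n \<le> m \<and> m \<le> nprimes \<alpha> \<and> factorization (partial_rat \<alpha> m) (\<nu> r)
           \<and> (\<forall>i. slot (\<nu> s) i \<le> slot (\<nu> r) i)"
  using assms(3)
proof (induction rule: converse_rtrancl_induct)
  case base
  thus ?case using assms(4,5) by blast
next
  case (step y z)
  then obtain m where m: "n \<le> m" "m \<le> nprimes \<alpha>" "factorization (partial_rat \<alpha> m) (\<nu> z)"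
    "\<And>i. slot (\<nu> s) i \<le> slot (\<nu> z) i" by blast
  have "y \<in> vertices T - {root_vertex T}" "z = parent T y"
    using step.hyps(1) by (auto simp: parent_rel_def)
  then obtain k where k: "direct_subfactorization \<alpha> k (\<nu> z) (\<nu> y)"
    using assms(2) unfolding factorization_tree_def by blast
  hence k': "k < nprimes \<alpha>" "factorization (partial_rat \<alpha> k) (\<nu> z)"
    "factorization (partial_rat \<alpha> (k + 1)) (\<nu> y)"
    by (auto simp: direct_subfactorization_def)
  \<comment> \<open>The edge provides some index \<open>k\<close> for the parent; injectivity
    identifies it with the index reached so far.\<close>
  have "k = m"
    using partial_rat_inj[OF assms(1) factorization_unique[OF k'(2) m(3)]] k'(1) m(2) by simp
  thus ?case
    using k' m direct_subfactorization_slot_mono[OF k] by (intro exI[of _ "k + 1"]) (auto intro: le_trans)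
qed

section \<open>Cost of appending the later primes\<close>

lemma log_mahler_signed_prime:
  assumes "Factorial_Ring.prime (nth_prime \<alpha> i)"
  shows "log_mahler (of_rat (of_nat (nth_prime \<alpha> i) powi gamma_sign \<alpha> i)) = ln (real (nth_prime \<alpha> i))"
proof -
  have p: "nth_prime \<alpha> i > 0" using assms by (rule prime_gt_0_nat)
  show ?thesis
  proof (cases "nth_prime \<alpha> i dvd numer \<alpha>")
    case True
    thus ?thesis using log_mahler_of_rat[of "nth_prime \<alpha> i" 1] p by (simp add: gamma_sign_def max_def)
  next
    case False
    thus ?thesis using log_mahler_of_rat[of 1 "nth_prime \<alpha> i"] p
      by (simp add: gamma_sign_def max_def of_rat_inverse power_int_minus divide_inverse)
  qed
qed

text \<open>A rational factorization of \<alpha>_n, extended by the signed primes from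
  \<open>n+1\<close> to \<open>m\<close> as single factors, is a factorization of \<alpha>_m and
  competes in its infimum.\<close>

lemma metric_mahler_partial_rat_le:
  fixes M :: nat
  assumes "\<alpha> > 0" "n \<le> m" "m \<le> nprimes \<alpha>"
    and "\<And>j. j \<in> {1..M} \<Longrightarrow> x j > 0 \<and> y j > 0"
    and "(\<Prod>j=1..M. x j) = num_on \<alpha> {1..n}" "(\<Prod>j=1..M. y j) = den_on \<alpha> {1..n}"
  shows "metric_mahler t (of_rat (partial_rat \<alpha> m)) \<le>
     ((\<Sum>j=1..M. ln (real (max (x j) (y j))) powr t) +
      (\<Sum>i=n+1..m. ln (real (nth_prime \<alpha> i)) powr t)) powr (1 / t)"
proof -
  have n: "{1..n} \<subseteq> {1..nprimes \<alpha>}" "n \<le> nprimes \<alpha>" using assms(2,3) by auto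
  define q :: "nat \<Rightarrow> rat" where "q = (\<lambda>i. of_nat (nth_prime \<alpha> i) powi gamma_sign \<alpha> i)"
  \<comment> \<open>Positions \<open>1..M\<close> hold the given fractions; the prime with index
    \<open>i\<close> sits at position \<open>i + M - n\<close>.\<close>
  define w :: "nat \<Rightarrow> complex" where
    "w = (\<lambda>j. if j \<le> M then of_nat (x j) / of_nat (y j) else of_rat (q (n + j - M)))"
  have prime: "Factorial_Ring.prime (nth_prime \<alpha> i)" if "i \<in> {n+1..m}" for i
    using that assms(1,3) nth_prime_mem(1)[of \<alpha> i] by auto
  have cop: "Rings.coprime (x j) (y j)" if "j \<in> {1..M}" for j
  proof -
    have "x j dvd num_on \<alpha> {1..n}" "y j dvd den_on \<alpha> {1..n}"
      unfolding assms(5,6)[symmetric] using that by (auto intro: dvd_prodI)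
    thus ?thesis using Rings.coprime_divisors coprime_num_den[OF assms(1) n(1)] by blast
  qed
  have split_sum: "(\<Sum>j=1..M+(m-n). h j) = (\<Sum>j=1..M. h j) + (\<Sum>i=n+1..m. h (i + M - n))"
    for h :: "nat \<Rightarrow> real"
  proof -
    have "(\<Sum>j=1..M+(m-n). h j) = (\<Sum>j=1..M. h j) + (\<Sum>j=M+1..M+(m-n). h j)"
      by (rule sum.ub_add_nat) simp
    also have "(\<Sum>j=M+1..M+(m-n). h j) = (\<Sum>i=n+1..m. h (i + M - n))"
      by (rule sum.reindex_bij_witness[of _ "\<lambda>i. i + M - n" "\<lambda>j. n + j - M"]) (use assms(2) in auto)
    finally show ?thesis .
  qed
  have split_prod: "(\<Prod>j=1..M+(m-n). h j) = (\<Prod>j=1..M. h j) * (\<Prod>i=n+1..m. h (i + M - n))"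
    for h :: "nat \<Rightarrow> complex"
  proof -
    have "(\<Prod>j=1..M+(m-n). h j) = (\<Prod>j=1..M. h j) * (\<Prod>j=M+1..M+(m-n). h j)"
      by (rule prod.ub_add_nat) simp
    also have "(\<Prod>j=M+1..M+(m-n). h j) = (\<Prod>i=n+1..m. h (i + M - n))"
      by (rule prod.reindex_bij_witness[of _ "\<lambda>i. i + M - n" "\<lambda>j. n + j - M"]) (use assms(2) in auto)
    finally show ?thesis .
  qed
  have w_tail: "w (i + M - n) = of_rat (q i)" if "i \<in> {n+1..m}" for i
    using that by (auto simp: w_def)
  have "w j \<noteq> 0 \<and> algebraic (w j)" if j: "j \<in> {1..M+(m-n)}" for j
  proof (cases "j \<le> M")
    case True
    thus ?thesis using assms(4)[of j] j by (auto simp: w_def intro!: rat_imp_algebraic)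
  next
    case False
    hence "n + j - M \<in> {n+1..m}" using j assms(2) by auto
    from prime[OF this] have "q (n + j - M) \<noteq> 0" by (auto simp: q_def dest: prime_gt_0_nat)
    thus ?thesis using False by (auto simp: w_def intro!: rat_imp_algebraic)
  qed
  moreover have "of_rat (partial_rat \<alpha> m) = (\<Prod>j=1..M+(m-n). w j)"
  proof -
    have "(\<Prod>j=1..M. w j) = (\<Prod>j=1..M. of_nat (x j) / of_nat (y j))"
      by (intro prod.cong) (auto simp: w_def)
    also have "\<dots> = of_nat (\<Prod>j=1..M. x j) / of_nat (\<Prod>j=1..M. y j)"
      by (simp add: prod_dividef)
    also have "\<dots> = of_rat (partial_rat \<alpha> n)"
      unfolding assms(5,6) by (simp add: partial_rat_altdef[OF assms(1) n(2)] of_rat_divide)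
    finally have 1: "(\<Prod>j=1..M. w j) = of_rat (partial_rat \<alpha> n)" .
    have "(\<Prod>i=n+1..m. w (i + M - n)) = (\<Prod>i=n+1..m. of_rat (q i))"
      by (intro prod.cong refl w_tail)
    also have "\<dots> = of_rat (\<Prod>i=n+1..m. q i)" by (simp add: of_rat_prod)
    finally show ?thesis
      unfolding split_prod 1 partial_rat_split[OF assms(1,2)] q_def by (simp add: of_rat_mult)
  qed
  ultimately have "metric_mahler t (of_rat (partial_rat \<alpha> m))
      \<le> (\<Sum>j=1..M+(m-n). log_mahler (w j) powr t) powr (1 / t)"
    by (intro metric_mahler_le) auto
  also have "(\<Sum>j=1..M+(m-n). log_mahler (w j) powr t) =
      (\<Sum>j=1..M. ln (real (max (x j) (y j))) powr t) +
      (\<Sum>i=n+1..m. ln (real (nth_prime \<alpha> i)) powr t)"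
  proof -
    have "(\<Sum>j=1..M. log_mahler (w j) powr t) = (\<Sum>j=1..M. ln (real (max (x j) (y j))) powr t)"
    proof (intro sum.cong refl)
      fix j assume j: "j \<in> {1..M}"
      have "log_mahler (w j) = ln (real (max (x j) (y j)))"
        using log_mahler_of_rat[OF cop[OF j]] assms(4)[OF j] j by (simp add: w_def)
      thus "log_mahler (w j) powr t = ln (real (max (x j) (y j))) powr t" by simp
    qed
    moreover have "(\<Sum>i=n+1..m. log_mahler (w (i + M - n)) powr t)
        = (\<Sum>i=n+1..m. ln (real (nth_prime \<alpha> i)) powr t)"
    proof (intro sum.cong refl)
      fix i assume i: "i \<in> {n+1..m}"
      show "log_mahler (w (i + M - n)) powr t = ln (real (nth_prime \<alpha> i)) powr t"
        unfolding w_tail[OF i] q_def log_mahler_signed_prime[OF prime[OF i]] ..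
    qed
    ultimately show ?thesis unfolding split_sum by simp
  qed
  finally show ?thesis .
qed

text \<open>A nontrivial entry has a prime factor, which is one of the first \<open>n\<close> primes
  because the entry divides the numerator or the denominator of \<alpha>_n. By separation that
  factor exceeds every later prime.\<close>

lemma separation_prime_less_slot:
  assumes "\<alpha> > 0" "separation_index \<alpha> n" "factorization (partial_rat \<alpha> n) f"
    and "i \<in> nontrivial f" "j \<in> {n+1..nprimes \<alpha>}"
  shows "nth_prime \<alpha> j < slot f i"
proof -
  have n: "n \<le> nprimes \<alpha>" "{1..n} \<subseteq> {1..nprimes \<alpha>}"
    using assms(2) by (auto simp: separation_index_def)
  have slot: "slot f i \<ge> 2" using slot_nontrivial assms(3,4) by blast
  then obtain p where p: "Factorial_Ring.prime p" "p dvd slot f i"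
    using prime_factor_nat[of "slot f i"] by auto
  have "(\<Prod>i\<in>nontrivial f. top_of f i) = num_on \<alpha> {1..n} \<and> (\<Prod>i\<in>nontrivial f. bot_of f i) = den_on \<alpha> {1..n}"
    using assms(3) coprime_num_den[OF assms(1) n(2)] num_den_pos[OF assms(1) n(2)]
    by (intro factorization_prods) (simp_all add: partial_rat_altdef[OF assms(1) n(1)])
  hence "top_of f i dvd num_on \<alpha> {1..n}" "bot_of f i dvd den_on \<alpha> {1..n}"
    using assms(4) factorization_facts(4)[OF assms(3)] dvd_prodI[of "nontrivial f" i "top_of f"]
      dvd_prodI[of "nontrivial f" i "bot_of f"] by auto
  hence "slot f i dvd num_on \<alpha> {1..n} * den_on \<alpha> {1..n}"
    by (auto simp: slot_def max_def)
  hence "p dvd prod (nth_prime \<alpha>) {1..n}"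
    using p(2) num_mult_den[OF assms(1) n(2)] by (metis dvd_trans)
  then obtain i' where i': "i' \<in> {1..n}" "p dvd nth_prime \<alpha> i'"
    using p(1) by (subst (asm) prime_dvd_prod_iff) auto
  hence "p = nth_prime \<alpha> i'"
    using p(1) nth_prime_mem(1)[OF assms(1)] n(2) primes_dvd_imp_eq by blast
  hence "nth_prime \<alpha> j < p"
    using separation_index_less[OF assms(1,2) i'(1) assms(5)] by simp
  also have "p \<le> slot f i" using p(2) slot by (intro dvd_imp_le) auto
  finally show ?thesis .
qed

section \<open>Optimality at separation vertices\<close>

theorem theorem3p6:
  fixes \<alpha> :: rat and T :: "'v rooted_tree" and \<nu> :: "'v \<Rightarrow> fact_seq" and r s :: 'v
  assumes "\<alpha> > 0"
    and "primitive_factorization_tree \<alpha> T \<nu>"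
    and "r \<in> vertices T"
    and "\<exists>n\<le>nprimes \<alpha>. optimal_factorization (partial_rat \<alpha> n) (\<nu> r)"
    and "separation_vertex \<alpha> T \<nu> s"
    and "is_ancestor T s r"
  shows "\<exists>n\<le>nprimes \<alpha>. optimal_factorization (partial_rat \<alpha> n) (\<nu> s)"
proof -
  obtain n where sep: "separation_index \<alpha> n" and f: "factorization (partial_rat \<alpha> n) (\<nu> s)"
    using assms(5) by (auto simp: separation_vertex_def)
  have n: "n \<le> nprimes \<alpha>" "{1..n} \<subseteq> {1..nprimes \<alpha>}"
    using sep by (auto simp: separation_index_def)
  have rs: "(r, s) \<in> (parent_rel T)\<^sup>*" and tree: "factorization_tree \<alpha> T \<nu>"
    using assms(2,6) by (auto simp: is_ancestor_def primitive_factorization_tree_def)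
  obtain m where m: "n \<le> m" "m \<le> nprimes \<alpha>"
    and g: "factorization (partial_rat \<alpha> m) (\<nu> r)"
    and slot_le: "\<And>i. slot (\<nu> s) i \<le> slot (\<nu> r) i"
    using descendant_factorization[OF assms(1) tree rs f n(1)] by blast
  obtain m' where m': "m' \<le> nprimes \<alpha>" "optimal_factorization (partial_rat \<alpha> m') (\<nu> r)"
    using assms(4) by blast
  \<comment> \<open>A sequence determines its product, so optimality transfers to the index reached
    along the branch.\<close>
  hence "partial_rat \<alpha> m' = partial_rat \<alpha> m"
    using factorization_unique g by (auto simp: optimal_factorization_def)
  with m'(2) obtain T0 where T0: "T0 > 0" and opt: "\<And>t. t \<ge> T0 \<Longrightarrow>
      metric_mahler t (of_rat (partial_rat \<alpha> m)) =
        (\<Sum>i\<in>nontrivial (\<nu> r). ln (real (slot (\<nu> r) i)) powr t) powr (1 / t)"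
    by (auto simp: optimal_factorization_def suminf_slot[OF g])

  let ?A = "num_on \<alpha> {1..n}" and ?B = "den_on \<alpha> {1..n}"
  have AB: "?A > 0" "?B > 0" "Rings.coprime ?A ?B"
    "(of_rat (partial_rat \<alpha> n) :: complex) = of_nat ?A / of_nat ?B"
    using num_den_pos[OF assms(1) n(2)] coprime_num_den[OF assms(1) n(2)]
    by (simp_all add: partial_rat_altdef[OF assms(1) n(1)] of_rat_divide)
  \<comment> \<open>Trivial entries are left out, so that all elements of \<open>U\<close> are at
    least 2, as the comparison requires.\<close>
  define U where "U = image_mset (slot (\<nu> s)) (mset_set (nontrivial (\<nu> s)))"
  define Q where "Q = image_mset (nth_prime \<alpha>) (mset_set {n+1..m})"
  have fin: "finite (nontrivial (\<nu> s))" "finite (nontrivial (\<nu> r))"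
    using factorization_facts(4) f g by blast+
  have U_sum: "log_pow_sum t U = (\<Sum>i\<in>nontrivial (\<nu> s). ln (real (slot (\<nu> s) i)) powr t)" for t
    by (simp add: U_def log_pow_sum_def sum_unfold_sum_mset multiset.map_comp o_def)
  have Q_sum: "log_pow_sum t Q = (\<Sum>i=n+1..m. ln (real (nth_prime \<alpha> i)) powr t)" for t
    by (simp add: Q_def log_pow_sum_def sum_unfold_sum_mset multiset.map_comp o_def)
  have U2: "u \<ge> 2" if "u \<in># U" for u
    using that fin slot_nontrivial[OF f] by (auto simp: U_def)
  have QU: "q < u" if "q \<in># Q" "u \<in># U" for q u
    using that fin m separation_prime_less_slot[OF assms(1) sep f] by (auto simp: U_def Q_def)
  \<comment> \<open>The bound \<open>?A * ?B\<close> covers all rational factorizations of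
    \<alpha>_n at once: max(x, y) is at most xy for positive integers, whatever the number of
    factors.\<close>
  have "\<forall>\<^sub>F t in at_top. \<forall>I (z :: nat \<Rightarrow> nat). finite I \<longrightarrow> (\<forall>j\<in>I. z j > 0) \<longrightarrow>
      prod z I \<le> ?A * ?B \<longrightarrow> (\<Sum>j\<in>I. ln (real (z j)) powr t) < log_pow_sum t U \<longrightarrow>
      (\<Sum>j\<in>I. ln (real (z j)) powr t) + log_pow_sum t Q < log_pow_sum t U"
    by (rule eventually_log_sum_append_less) (fact U2 QU)+
  then obtain T1 where T1: "\<forall>t\<ge>T1. \<forall>I (z :: nat \<Rightarrow> nat). finite I \<longrightarrow> (\<forall>j\<in>I. z j > 0) \<longrightarrow>
      prod z I \<le> ?A * ?B \<longrightarrow> (\<Sum>j\<in>I. ln (real (z j)) powr t) < log_pow_sum t U \<longrightarrow>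
      (\<Sum>j\<in>I. ln (real (z j)) powr t) + log_pow_sum t Q < log_pow_sum t U"
    unfolding eventually_at_top_linorder by (elim exE)
  \<comment> \<open>The infimum uses finite products indexed from 1, while \<open>\<nu> s\<close> is
    indexed from 0; factor \<open>i\<close> below is entry \<open>i - 1\<close>, up to
    \<open>K\<close>.\<close>
  obtain K where K: "nontrivial (\<nu> s) \<subseteq> {..<K}"
    using finite_nat_iff_bounded fin(1) by blast

  have "metric_mahler t (of_rat (partial_rat \<alpha> n)) = log_pow_sum t U powr (1 / t)"
    if t: "t \<ge> max T0 T1" for t
  proof (rule metric_mahler_eqI)
    let ?w = "\<lambda>i. of_nat (top_of (\<nu> s) (i - 1)) / of_nat (bot_of (\<nu> s) (i - 1)) :: complex"
    show t0: "t > 0" using t T0 by simp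
    show "\<forall>i\<in>{1..K}. algebraic (?w i) \<and> ?w i \<noteq> 0"
      using factorization_facts(1,2)[OF f] by (auto intro!: rat_imp_algebraic simp: neq0_conv)
    have "(\<Prod>i=1..K. ?w i) = (\<Prod>i<K. of_nat (top_of (\<nu> s) i) / of_nat (bot_of (\<nu> s) i))"
      by (rule prod.reindex_bij_witness[of _ Suc "\<lambda>i. i - 1"]) auto
    also have "\<dots> = of_rat (\<Prod>i<K. of_nat (top_of (\<nu> s) i) / of_nat (bot_of (\<nu> s) i))"
      by (simp add: of_rat_divide of_rat_prod)
    also have "\<dots> = of_rat (partial_rat \<alpha> n)"
      using factorization_value[OF f _ K] by simp
    finally show "of_rat (partial_rat \<alpha> n) = (\<Prod>i=1..K. ?w i)" ..
    have "(\<Sum>i=1..K. log_mahler (?w i) powr t) = (\<Sum>i<K. ln (real (slot (\<nu> s) i)) powr t)"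
      unfolding log_mahler_slot[OF f]
      by (rule sum.reindex_bij_witness[of _ Suc "\<lambda>i. i - 1"]) auto
    thus "(\<Sum>i=1..K. log_mahler (?w i) powr t) = log_pow_sum t U"
      unfolding U_sum using sum_slot_eq[OF _ K] by simp
  next
    fix M :: nat and w :: "nat \<Rightarrow> complex"
    assume w: "\<forall>i\<in>{1..M}. algebraic (w i) \<and> w i \<noteq> 0"
      "of_rat (partial_rat \<alpha> n) = (\<Prod>i=1..M. w i)"
    obtain x y where xy: "(\<Prod>i=1..M. x i) = ?A" "(\<Prod>i=1..M. y i) = ?B"
      and pos: "\<And>i. i \<in> {1..M} \<Longrightarrow> x i > 0 \<and> y i > 0"
      and le: "\<And>i. i \<in> {1..M} \<Longrightarrow> ln (real (max (x i) (y i))) \<le> log_mahler (w i)"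
      using rational_factorization_below[of "{1..M}" w ?A ?B] w AB by auto
    define z where "z = (\<lambda>i. max (x i) (y i))"
    have z: "\<forall>i\<in>{1..M}. z i > 0" using pos by (auto simp: z_def less_max_iff_disj)
    have "prod z {1..M} \<le> (\<Prod>i=1..M. x i * y i)"
      using pos by (intro prod_mono) (auto simp: z_def Suc_le_eq)
    also have "\<dots> = ?A * ?B" by (simp only: prod.distrib xy)
    finally have zAB: "prod z {1..M} \<le> ?A * ?B" .
    \<comment> \<open>If \<open>z\<close> were cheaper, it would stay cheaper than
      \<open>\<nu> s\<close> after appending \<open>Q\<close>, and hence be cheaper than
      \<open>\<nu> r\<close>. The appended list factors \<alpha>_m, which contradicts
      \<open>opt\<close>.\<close>
    have "log_pow_sum t U \<le> (\<Sum>i=1..M. ln (real (z i)) powr t)"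
    proof (rule ccontr)
      assume "\<not> log_pow_sum t U \<le> (\<Sum>i=1..M. ln (real (z i)) powr t)"
      hence "(\<Sum>i=1..M. ln (real (z i)) powr t) + log_pow_sum t Q < log_pow_sum t U"
        using T1[rule_format, of t "{1..M}" z] t z zAB by simp
      also have "log_pow_sum t U \<le> (\<Sum>i\<in>nontrivial (\<nu> r). ln (real (slot (\<nu> r) i)) powr t)"
      proof -
        \<comment> \<open>On a common index set the sums compare entry by entry; the added entries
          equal 1 and contribute 0.\<close>
        let ?S = "nontrivial (\<nu> s) \<union> nontrivial (\<nu> r)"
        have "log_pow_sum t U = (\<Sum>i\<in>?S. ln (real (slot (\<nu> s) i)) powr t)"
          unfolding U_sum using fin by (intro sum_slot_eq[symmetric]) auto
        also have "\<dots> \<le> (\<Sum>i\<in>?S. ln (real (slot (\<nu> r) i)) powr t)"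
        proof (intro sum_mono powr_mono2)
          fix i
          have "slot (\<nu> s) i > 0" using factorization_facts(1)[OF f, of i] by (simp add: slot_def)
          thus "0 \<le> ln (real (slot (\<nu> s) i))" "ln (real (slot (\<nu> s) i)) \<le> ln (real (slot (\<nu> r) i))"
            using slot_le[of i] by simp_all
        qed (use t T0 in simp)
        also have "\<dots> = (\<Sum>i\<in>nontrivial (\<nu> r). ln (real (slot (\<nu> r) i)) powr t)"
          using fin by (intro sum_slot_eq) auto
        finally show ?thesis .
      qed
      finally have "((\<Sum>i=1..M. ln (real (z i)) powr t) + log_pow_sum t Q) powr (1 / t)
          < (\<Sum>i\<in>nontrivial (\<nu> r). ln (real (slot (\<nu> r) i)) powr t) powr (1 / t)"
        using t T0 by (intro powr_less_mono2) (auto intro!: add_nonneg_nonneg sum_nonneg)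
      moreover have "metric_mahler t (of_rat (partial_rat \<alpha> m))
          \<le> ((\<Sum>i=1..M. ln (real (z i)) powr t) + log_pow_sum t Q) powr (1 / t)"
        unfolding z_def Q_sum
        by (rule metric_mahler_partial_rat_le[OF assms(1) m pos xy])
      ultimately show False using opt[of t] t by simp
    qed
    also have "\<dots> \<le> (\<Sum>i=1..M. log_mahler (w i) powr t)"
      using t T0 z le by (intro sum_mono powr_mono2) (auto simp: z_def Suc_le_eq)
    finally show "log_pow_sum t U \<le> (\<Sum>i=1..M. log_mahler (w i) powr t)" .
  qed
  hence "optimal_factorization (partial_rat \<alpha> n) (\<nu> s)"
    unfolding optimal_factorization_def suminf_slot[OF f] U_sum
    using f T0 by (intro conjI exI[of _ "max T0 T1"]) auto
  thus ?thesis using n(1) by blast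
qed

end
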